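(* Let $\mathbb{K}$ be $\mathbb{R}$ or $\mathbb{C}$, and let $A$ be a C*-algebra over $\mathbb{K}$ with presentation $A^\dagger=(A,\overline{a})$, where $\|a_j\|\le 1$ for all $j$. Then $A^\dagger$ is computable if and only if the word problem of $A^\dagger$ is strongly computable closed.
   Context: A C*-algebra over $\mathbb{K}\in\{\mathbb{R},\mathbb{C}\}$ is a Banach *-algebra over $\mathbb{K}$ (not necessarily unital) that is isometrically *-isomorphic to a norm-closed *-subalgebra of the bounded operators on a Hilbert space over $\mathbb{K}$. A presentation $A^\dagger=(A,\overline{a})$ of a separable C*-algebra $A$ over $\mathbb{K}$ consists of $A$ and a countable (finite or infinite) sequence $\overline{a}$ of elements (the special points) generating $A$ as a C*-algebra over $\mathbb{K}$. A polynomial is rational if its coefficients lie in $\mathbb{Q}$ (when $\mathbb{K}=\mathbb{R}$) or $\mathbb{Q}(i)$ (when $\mathbb{K}=\mathbb{C}$). A rational point of $A^\dagger$ is an element $p(a_{i_1},\ldots,a_{i_n})$ with $p$ a rational noncommutative *-polynomial with no constant term (as input to an algorithm it is given by $p$ and the indices). $A^\dagger$ is computable if there is an effective procedure which, given a rational point $r$ and $k\in\mathbb{N}$, returns $q\in\mathbb{Q}$ with $|\|r\|-q|<2^{-k}$. Word problem: for $n\in\mathbb{N}\cup\{\omega\}$, $\mathcal{F}(n;\mathbb{K})$ is the universal contraction C*-algebra over $\mathbb{K}$ on $n$ generators $\overline{c}$ (countably infinitely many if $n=\omega$): it is generated by elements $c_j$ with $\|c_j\|\le 1$, and for any elements $b_j$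 of norm at most 1 in a C*-algebra $B$ over $\mathbb{K}$ there is a unique *-homomorphism $\mathcal{F}(n;\mathbb{K})\to B$ with $c_j\mapsto b_j$. Its standard presentation, with special points $\overline{c}$, is computable. The word problem of $(A,\overline{a})$, where $\|a_j\|\le1$ for all $j$, is the kernel of the natural quotient map $\mathcal{F}(|\overline{a}|;\mathbb{K})\to A$, $c_j\mapsto a_j$, viewed as a closed subset of $\mathcal{F}(|\overline{a}|;\mathbb{K})$ with its standard presentation. For a computable presentation $F^\dagger$ of $F$, an open (resp. closed) rational ball is an open (resp. closed) ball centered at a rational point with positive dyadic rational radius. A closed set $S\subseteq F$ is c.e. closed if the set of all open rational balls that intersect $S$ is c.e.; strongly co-c.e. closed if the set of all closed rational balls that do not intersect $S$ is c.e.; strongly computable closed if it is both c.e. closed and strongly co-c.e. closed. *)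

theory Defs
  imports "HOL-Analysis.Analysis" "HOL-Library.Nat_Bijection" "HOL-Library.Countable"
begin

section \<open>Banach *-algebras and C*-algebras over the real or complex field\<close>

text \<open>
  The scalar field is a set \<open>K\<close> of complex numbers, namely \<open>\<real>\<close> or \<open>UNIV\<close>. Addition, real
  scaling and the norm of an algebra are those of its underlying type; \<open>scl\<close> is multiplication by
  scalars and is only meaningful for scalars in \<open>K\<close>.
\<close>

record 'a star_algebra =
  scl :: "complex \<Rightarrow> 'a \<Rightarrow> 'a"
  mul :: "'a \<Rightarrow> 'a \<Rightarrow> 'a"
  adj :: "'a \<Rightarrow> 'a"

locale banach_star_algebra =
  fixes K :: "complex set" and A :: "'a::banach star_algebra"
  assumes scl_add_left: "c \<in> K \<Longrightarrow> d \<in> K \<Longrightarrow> scl A (c + d) x = scl A c x + scl A d x"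
    and scl_add_right: "c \<in> K \<Longrightarrow> scl A c (x + y) = scl A c x + scl A c y"
    and scl_scl: "c \<in> K \<Longrightarrow> d \<in> K \<Longrightarrow> scl A c (scl A d x) = scl A (c * d) x"
    and scl_of_real: "scl A (complex_of_real r) x = r *\<^sub>R x"
    and norm_scl: "c \<in> K \<Longrightarrow> norm (scl A c x) = cmod c * norm x"
    and mul_assoc: "mul A (mul A x y) z = mul A x (mul A y z)"
    and mul_add_left: "mul A (x + y) z = mul A x z + mul A y z"
    and mul_add_right: "mul A x (y + z) = mul A x y + mul A x z"
    and mul_scl_left: "c \<in> K \<Longrightarrow> mul A (scl A c x) y = scl A c (mul A x y)"
    and mul_scl_right: "c \<in> K \<Longrightarrow> mul A x (scl A c y) = scl A c (mul A x y)"
    and norm_mul: "norm (mul A x y) \<le> norm x * norm y"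
    and adj_adj: "adj A (adj A x) = x"
    and adj_add: "adj A (x + y) = adj A x + adj A y"
    and adj_scl: "c \<in> K \<Longrightarrow> adj A (scl A c x) = scl A (cnj c) (adj A x)"
    and adj_mul: "adj A (mul A x y) = mul A (adj A y) (adj A x)"
    and norm_adj: "norm (adj A x) = norm x"

definition star_hom ::
  "complex set \<Rightarrow> 'a::banach star_algebra \<Rightarrow> 'b::banach star_algebra \<Rightarrow> ('a \<Rightarrow> 'b) \<Rightarrow> bool" where
  "star_hom K A B \<phi> \<longleftrightarrow>
     (\<forall>x y. \<phi> (x + y) = \<phi> x + \<phi> y) \<and>
     (\<forall>c\<in>K. \<forall>x. \<phi> (scl A c x) = scl B c (\<phi> x)) \<and>
     (\<forall>x y. \<phi> (mul A x y) = mul B (\<phi> x) (\<phi> y)) \<and>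
     (\<forall>x. \<phi> (adj A x) = adj B (\<phi> x))"

definition closed_star_subalgebra ::
  "complex set \<Rightarrow> 'a::banach star_algebra \<Rightarrow> 'a set \<Rightarrow> bool" where
  "closed_star_subalgebra K A S \<longleftrightarrow>
     closed S \<and> 0 \<in> S \<and>
     (\<forall>x\<in>S. \<forall>y\<in>S. x + y \<in> S) \<and>
     (\<forall>c\<in>K. \<forall>x\<in>S. scl A c x \<in> S) \<and>
     (\<forall>x\<in>S. \<forall>y\<in>S. mul A x y \<in> S) \<and>
     (\<forall>x\<in>S. adj A x \<in> S)"

text \<open>Hilbert spaces over \<open>K\<close>; the inner product is linear in its first argument.\<close>

record 'h hilbert_structure =
  hscl :: "complex \<Rightarrow> 'h \<Rightarrow> 'h"
  hip :: "'h \<Rightarrow> 'h \<Rightarrow> complex"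

locale hilbert_space =
  fixes K :: "complex set" and H :: "'h::{real_inner,banach} hilbert_structure"
  assumes hscl_add_left: "c \<in> K \<Longrightarrow> d \<in> K \<Longrightarrow> hscl H (c + d) x = hscl H c x + hscl H d x"
    and hscl_add_right: "c \<in> K \<Longrightarrow> hscl H c (x + y) = hscl H c x + hscl H c y"
    and hscl_hscl: "c \<in> K \<Longrightarrow> d \<in> K \<Longrightarrow> hscl H c (hscl H d x) = hscl H (c * d) x"
    and hscl_of_real: "hscl H (complex_of_real r) x = r *\<^sub>R x"
    and hip_in: "hip H x y \<in> K"
    and hip_add: "hip H (x + y) z = hip H x z + hip H y z"
    and hip_hscl: "c \<in> K \<Longrightarrow> hip H (hscl H c x) y = c * hip H x y"
    and hip_sym: "hip H y x = cnj (hip H x y)"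
    and hip_self: "hip H x x = complex_of_real ((norm x)\<^sup>2)"

definition operators ::
  "complex set \<Rightarrow> 'h::{real_inner,banach} hilbert_structure \<Rightarrow> ('h \<Rightarrow>\<^sub>L 'h) set" where
  "operators K H = {T. \<forall>c\<in>K. \<forall>u. blinfun_apply T (hscl H c u) = hscl H c (blinfun_apply T u)}"

definition is_adjoint ::
  "'h::{real_inner,banach} hilbert_structure \<Rightarrow> ('h \<Rightarrow>\<^sub>L 'h) \<Rightarrow> ('h \<Rightarrow>\<^sub>L 'h) \<Rightarrow> bool" where
  "is_adjoint H T T' \<longleftrightarrow>
     (\<forall>u v. hip H (blinfun_apply T u) v = hip H u (blinfun_apply T' v))"

definition concrete_cstar_algebra ::
  "complex set \<Rightarrow> 'h::{real_inner,banach} hilbert_structure \<Rightarrow> ('h \<Rightarrow>\<^sub>L 'h) set \<Rightarrow> bool" where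
  "concrete_cstar_algebra K H S \<longleftrightarrow>
     S \<subseteq> operators K H \<and> closed S \<and> 0 \<in> S \<and>
     (\<forall>T\<in>S. \<forall>U\<in>S. T + U \<in> S) \<and>
     (\<forall>c\<in>K. \<forall>T\<in>S. \<exists>U\<in>S. \<forall>u. blinfun_apply U u = hscl H c (blinfun_apply T u)) \<and>
     (\<forall>T\<in>S. \<forall>U\<in>S. T o\<^sub>L U \<in> S) \<and>
     (\<forall>T\<in>S. \<exists>T'\<in>S. is_adjoint H T T')"

text \<open>*-homomorphisms of an algebra into the algebra of all bounded operators on \<open>H\<close>.\<close>

definition star_representation ::
  "complex set \<Rightarrow> 'a::banach star_algebra \<Rightarrow> 'h::{real_inner,banach} hilbert_structure \<Rightarrow>
     ('a \<Rightarrow> ('h \<Rightarrow>\<^sub>L 'h)) \<Rightarrow> bool" where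
  "star_representation K A H \<phi> \<longleftrightarrow>
     range \<phi> \<subseteq> operators K H \<and>
     (\<forall>x y. \<phi> (x + y) = \<phi> x + \<phi> y) \<and>
     (\<forall>c\<in>K. \<forall>x u. blinfun_apply (\<phi> (scl A c x)) u = hscl H c (blinfun_apply (\<phi> x) u)) \<and>
     (\<forall>x y. \<phi> (mul A x y) = \<phi> x o\<^sub>L \<phi> y) \<and>
     (\<forall>x. is_adjoint H (\<phi> x) (\<phi> (adj A x)))"

text \<open>
  HOL cannot quantify over the type underlying the Hilbert space, so that type is a parameter. When
  \<open>'h\<close> is a type variable, the hypothesis \<open>cstar_algebra TYPE('h) K A\<close> of a theorem covers all
  Hilbert spaces, as the theorem is universally quantified over \<open>'h\<close>.
\<close>

definition cstar_algebra ::
  "'h::{real_inner,banach} itself \<Rightarrow> complex set \<Rightarrow> 'a::banach star_algebra \<Rightarrow> bool" where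
  "cstar_algebra _ K A \<longleftrightarrow>
     banach_star_algebra K A \<and>
     (\<exists>(H :: 'h hilbert_structure) S \<rho>.
        hilbert_space K H \<and> concrete_cstar_algebra K H S \<and>
        star_representation K A H \<rho> \<and> range \<rho> = S \<and> (\<forall>x. norm (\<rho> x) = norm x))"


section \<open>Presentations and the universal contraction C*-algebra\<close>

text \<open>
  A countable sequence of length \<open>n\<close> is given by the values \<open>a j\<close> with \<open>enat j < n\<close>;
  \<open>n = \<infinity>\<close> is the case of an infinite sequence.
\<close>

definition presentation ::
  "complex set \<Rightarrow> 'a::banach star_algebra \<Rightarrow> enat \<Rightarrow> (nat \<Rightarrow> 'a) \<Rightarrow> bool" where
  "presentation K A n a \<longleftrightarrow>
     (\<forall>S. closed_star_subalgebra K A S \<and> (\<forall>j. enat j < n \<longrightarrow> a j \<in> S) \<longrightarrow> S = UNIV)"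

text \<open>
  The universal property of \<open>(F, c)\<close>, for target algebras \<open>B\<close> that are norm-closed *-algebras of
  operators on Hilbert spaces with underlying type \<open>'g\<close>. (Up to isomorphism every C*-algebra is of
  this form for some \<open>'g\<close>; again HOL cannot quantify over \<open>'g\<close> within a formula.)
\<close>

definition universal_property ::
  "'g::{real_inner,banach} itself \<Rightarrow> complex set \<Rightarrow> enat \<Rightarrow>
     'f::banach star_algebra \<Rightarrow> (nat \<Rightarrow> 'f) \<Rightarrow> bool" where
  "universal_property _ K n F c \<longleftrightarrow>
     (\<forall>(H :: 'g hilbert_structure) B b.
        hilbert_space K H \<and> concrete_cstar_algebra K H B \<and>
        (\<forall>j. enat j < n \<longrightarrow> b j \<in> B \<and> norm (b j) \<le> 1) \<longrightarrow>
        (\<exists>!\<phi>. star_representation K F H \<phi> \<and> range \<phi> \<subseteq> B \<and>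
              (\<forall>j. enat j < n \<longrightarrow> \<phi> (c j) = b j)))"

definition infinite_dimensional :: "'g::real_vector itself \<Rightarrow> bool" where
  "infinite_dimensional _ \<longleftrightarrow> (\<exists>X :: 'g set. independent X \<and> infinite X)"

text \<open>
  \<open>(F, c)\<close> is a model of the universal contraction C*-algebra on \<open>n\<close> generators. For a type \<open>'g\<close> of
  infinite dimension the universal property at \<open>'g\<close> implies the one for arbitrary C*-algebras:
  the C*-algebra generated by the \<open>b j\<close> is separable, hence acts faithfully on a separable Hilbert
  space, which embeds isometrically into \<open>'g\<close> (equipped with a complex structure when \<open>K = UNIV\<close>).
  So the universal property at any further type is a consequence of this definition, and stating it
  as well does not restrict \<open>(F, c)\<close>.
\<close>

definition universal_contraction_algebra ::
  "'k::{real_inner,banach} itself \<Rightarrow> 'g::{real_inner,banach} itself \<Rightarrow> complex set \<Rightarrow> enat \<Rightarrow>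
     'f::banach star_algebra \<Rightarrow> (nat \<Rightarrow> 'f) \<Rightarrow> bool" where
  "universal_contraction_algebra TK TG K n F c \<longleftrightarrow>
     cstar_algebra TK K F \<and> presentation K F n c \<and>
     (\<forall>j. enat j < n \<longrightarrow> norm (c j) \<le> 1) \<and>
     infinite_dimensional TG \<and> universal_property TG K n F c"

definition quotient_map ::
  "complex set \<Rightarrow> enat \<Rightarrow> 'f::banach star_algebra \<Rightarrow> (nat \<Rightarrow> 'f) \<Rightarrow>
     'a::banach star_algebra \<Rightarrow> (nat \<Rightarrow> 'a) \<Rightarrow> 'f \<Rightarrow> 'a" where
  "quotient_map K n F c A a =
     (THE \<pi>. star_hom K F A \<pi> \<and> (\<forall>j. enat j < n \<longrightarrow> \<pi> (c j) = a j))"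

definition word_problem ::
  "complex set \<Rightarrow> enat \<Rightarrow> 'f::banach star_algebra \<Rightarrow> (nat \<Rightarrow> 'f) \<Rightarrow>
     'a::banach star_algebra \<Rightarrow> (nat \<Rightarrow> 'a) \<Rightarrow> 'f set" where
  "word_problem K n F c A a = {x. quotient_map K n F c A a x = 0}"


section \<open>Partial recursive functions\<close>

text \<open>
  Functions take their arguments from a list; missing arguments count as \<open>0\<close> and superfluous ones
  are ignored, so that no arities need to be tracked. \<open>None\<close> means divergence.
\<close>

definition arg :: "nat list \<Rightarrow> nat \<Rightarrow> nat" where
  "arg xs i = (if i < length xs then xs ! i else 0)"

definition minimize :: "(nat \<Rightarrow> nat option) \<Rightarrow> nat option" where
  "minimize p =
     (if \<exists>k. p k = Some 0 \<and> (\<forall>i<k. p i \<noteq> None) then Some (LEAST k. p k = Some 0) else None)"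

inductive partial_recursive :: "(nat list \<Rightarrow> nat option) \<Rightarrow> bool" where
  zero: "partial_recursive (\<lambda>xs. Some 0)"
| succ: "partial_recursive (\<lambda>xs. Some (Suc (arg xs 0)))"
| proj: "partial_recursive (\<lambda>xs. Some (arg xs i))"
| comp: "partial_recursive f \<Longrightarrow> \<forall>g\<in>set gs. partial_recursive g \<Longrightarrow>
    partial_recursive (\<lambda>xs. Option.bind (those (map (\<lambda>g. g xs) gs)) f)"
| prim: "partial_recursive f \<Longrightarrow> partial_recursive g \<Longrightarrow>
    partial_recursive (\<lambda>xs. rec_nat (f (tl xs))
      (\<lambda>k r. Option.bind r (\<lambda>y. g (k # y # tl xs))) (arg xs 0))"
| mini: "partial_recursive f \<Longrightarrow> partial_recursive (\<lambda>xs. minimize (\<lambda>k. f (k # xs)))"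

definition ce :: "nat set \<Rightarrow> bool" where
  "ce S \<longleftrightarrow> (\<exists>f. partial_recursive f \<and> S = {e. f [e] \<noteq> None})"


section \<open>Rational points, computable presentations, computable closed sets\<close>

text \<open>
  A noncommutative *-polynomial is a finite formal sum of terms \<open>(coefficient, word)\<close>. In a word the
  letter \<open>Inl i\<close> stands for the \<open>i\<close>-th special point and \<open>Inr i\<close> for its adjoint; the absence of a
  constant term means that all words are nonempty.
\<close>

type_synonym star_polynomial = "(complex \<times> (nat + nat) list) list"

definition rational_polynomials :: "complex set \<Rightarrow> enat \<Rightarrow> star_polynomial set" where
  "rational_polynomials K n =
     {p. \<forall>(q, w)\<in>set p. q \<in> K \<and> Re q \<in> \<rat> \<and> Im q \<in> \<rat> \<and> w \<noteq> [] \<and>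
           (\<forall>l\<in>set w. enat (case_sum id id l) < n)}"

fun letter_value :: "'a::banach star_algebra \<Rightarrow> (nat \<Rightarrow> 'a) \<Rightarrow> nat + nat \<Rightarrow> 'a" where
  "letter_value A a (Inl i) = a i"
| "letter_value A a (Inr i) = adj A (a i)"

text \<open>The value at the empty word is irrelevant, since the algebra need not have a unit.\<close>

fun word_value :: "'a::banach star_algebra \<Rightarrow> (nat \<Rightarrow> 'a) \<Rightarrow> (nat + nat) list \<Rightarrow> 'a" where
  "word_value A a [] = 0"
| "word_value A a [l] = letter_value A a l"
| "word_value A a (l # l' # w) = mul A (letter_value A a l) (word_value A a (l' # w))"

definition point :: "'a::banach star_algebra \<Rightarrow> (nat \<Rightarrow> 'a) \<Rightarrow> star_polynomial \<Rightarrow> 'a" where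
  "point A a p = (\<Sum>(q, w)\<leftarrow>p. scl A q (word_value A a w))"

text \<open>Every rational polynomial has a code; codes need not be unique.\<close>

definition decode_term :: "nat \<Rightarrow> complex \<times> (nat + nat) list" where
  "decode_term m =
     (let (q, w) = prod_decode m; (r, s) = prod_decode q
      in (Complex (of_rat (nat_to_rat_surj r)) (of_rat (nat_to_rat_surj s)),
          map sum_decode (list_decode w)))"

definition decode_polynomial :: "nat \<Rightarrow> star_polynomial" where
  "decode_polynomial e = map decode_term (list_decode e)"

lemma rational_polynomial_has_code:
  assumes "p \<in> rational_polynomials K n"
  shows "p \<in> range decode_polynomial"
proof -
  have "t \<in> range decode_term" if "t \<in> set p" for t
  proof -
    obtain q w where t: "t = (q, w)" by (cases t)
    have "Re q \<in> \<rat>" "Im q \<in> \<rat>"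
      using assms that t by (auto simp: rational_polynomials_def)
    then obtain r s where rs: "Re q = of_rat r" "Im q = of_rat s"
      by (auto elim!: Rats_cases)
    obtain i j where ij: "nat_to_rat_surj i = r" "nat_to_rat_surj j = s"
      using surjD[OF surj_nat_to_rat_surj, of r] surjD[OF surj_nat_to_rat_surj, of s] by auto
    have "decode_term (prod_encode (prod_encode (i, j), list_encode (map sum_encode w))) = t"
      by (simp add: decode_term_def t ij rs[symmetric] comp_def)
    then show ?thesis by (rule range_eqI[OF sym])
  qed
  then have "\<exists>ts. p = map decode_term ts"
    by (simp add: ex_map_conv image_iff)
  then obtain ts where "map decode_term ts = p"
    by auto
  then have "decode_polynomial (list_encode ts) = p"
    by (simp add: decode_polynomial_def)
  then show ?thesis by (rule range_eqI[OF sym])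
qed

definition computable_presentation ::
  "complex set \<Rightarrow> 'a::banach star_algebra \<Rightarrow> enat \<Rightarrow> (nat \<Rightarrow> 'a) \<Rightarrow> bool" where
  "computable_presentation K A n a \<longleftrightarrow>
     (\<exists>f. partial_recursive f \<and>
        (\<forall>e k. decode_polynomial e \<in> rational_polynomials K n \<longrightarrow>
           (\<exists>v. f [e, k] = Some v \<and>
              \<bar>norm (point A a (decode_polynomial e)) - of_rat (nat_to_rat_surj v)\<bar> < 1 / 2 ^ k)))"

text \<open>Rational balls are coded by a rational point and a positive dyadic radius \<open>(m + 1) / 2\<^sup>k\<close>.\<close>

definition decode_ball :: "nat \<Rightarrow> star_polynomial \<times> real" where
  "decode_ball e =
     (let (p, r) = prod_decode e; (m, k) = prod_decode r
      in (decode_polynomial p, real (Suc m) / 2 ^ k))"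

definition ce_closed ::
  "complex set \<Rightarrow> 'f::banach star_algebra \<Rightarrow> enat \<Rightarrow> (nat \<Rightarrow> 'f) \<Rightarrow> 'f set \<Rightarrow> bool" where
  "ce_closed K F n c S \<longleftrightarrow> closed S \<and>
     ce {e. case decode_ball e of (p, r) \<Rightarrow>
              p \<in> rational_polynomials K n \<and> ball (point F c p) r \<inter> S \<noteq> {}}"

definition strongly_co_ce_closed ::
  "complex set \<Rightarrow> 'f::banach star_algebra \<Rightarrow> enat \<Rightarrow> (nat \<Rightarrow> 'f) \<Rightarrow> 'f set \<Rightarrow> bool" where
  "strongly_co_ce_closed K F n c S \<longleftrightarrow> closed S \<and>
     ce {e. case decode_ball e of (p, r) \<Rightarrow>
              p \<in> rational_polynomials K n \<and> cball (point F c p) r \<inter> S = {}}"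

definition strongly_computable_closed ::
  "complex set \<Rightarrow> 'f::banach star_algebra \<Rightarrow> enat \<Rightarrow> (nat \<Rightarrow> 'f) \<Rightarrow> 'f set \<Rightarrow> bool" where
  "strongly_computable_closed K F n c S \<longleftrightarrow>
     ce_closed K F n c S \<and> strongly_co_ce_closed K F n c S"

end

theory Submission
  imports Defs
begin

text \<open>
  Let \<open>\<pi>\<close> be the quotient map from \<open>F\<close> to \<open>A\<close>. Everything rests on the fact that each \<open>b\<close> in \<open>A\<close>
  has a lift of the same norm: then an open (closed) ball around \<open>p\<close> meets the kernel of \<open>\<pi>\<close> iff
  the norm of \<open>\<pi> p\<close> is less than (at most) the radius, so that the balls in question enumerate the
  strict upper and lower bounds of the norms of the rational points of \<open>A\<close>.

  No functional calculus is needed for the lift. If \<open>\<parallel>b\<parallel> \<le> 1\<close>, write \<open>b\<^sup>* b = 2u - u\<^sup>2\<close>, that is,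
  \<open>1 - u\<close> is a square root of \<open>1 - b\<^sup>* b\<close>; then \<open>z = b (2 - u)\<^sup>-\<^sup>1\<close> satisfies
  \<open>b (1 + z\<^sup>* z) = 2z\<close>. Conversely every \<open>w\<close> in \<open>F\<close> has a \<open>y\<close> with \<open>y (1 + w\<^sup>* w) = 2w\<close>, and
  \<open>\<parallel>y\<parallel> \<le> 1\<close> whatever \<open>w\<close> is. If \<open>\<pi> w = z\<close>, then \<open>\<pi> y = b\<close>. As long as only the density of the
  range of \<open>\<pi>\<close> is known, \<open>\<pi> w\<close> close to \<open>z\<close> yields \<open>\<pi> y\<close> close to \<open>b\<close>, from which surjectivity
  follows as in the open mapping theorem.
\<close>

section \<open>Norm-preserving lifts along *-homomorphisms\<close>

text \<open>The real part of the inner product of a complex Hilbert space is the real inner product of the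
  underlying type, so complex algebras are represented on real Hilbert spaces as well.\<close>

locale represented_star_algebra = banach_star_algebra K A
  for K :: "complex set" and A :: "'a::banach star_algebra" +
  fixes \<rho> :: "'a \<Rightarrow> 'h::real_inner \<Rightarrow> 'h"
  assumes real_scalar: "complex_of_real r \<in> K"
    and rep_add: "\<rho> (x + y) v = \<rho> x v + \<rho> y v"
    and rep_scaleR: "\<rho> (r *\<^sub>R x) v = r *\<^sub>R \<rho> x v"
    and rep_mul: "\<rho> (mul A x y) v = \<rho> x (\<rho> y v)"
    and rep_adj: "\<rho> x u \<bullet> v = u \<bullet> \<rho> (adj A x) v"
    and norm_rep: "norm (\<rho> x v) \<le> norm x * norm v"
    and norm_le_rep: "0 \<le> B \<Longrightarrow> (\<And>v. norm (\<rho> x v) \<le> B * norm v) \<Longrightarrow> norm x \<le> B"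
begin

section \<open>Positivity and quadratic equations in a single algebra\<close>

sublocale mul: bounded_bilinear "mul A"
proof
  show "mul A (r *\<^sub>R x) y = r *\<^sub>R mul A x y" for r x y
    using mul_scl_left[OF real_scalar] by (simp add: scl_of_real)
  show "mul A x (r *\<^sub>R y) = r *\<^sub>R mul A x y" for r x y
    using mul_scl_right[OF real_scalar] by (simp add: scl_of_real)
  show "\<exists>K. \<forall>x y. norm (mul A x y) \<le> norm x * norm y * K"
    using norm_mul by (metis mult.right_neutral)
qed (simp_all add: mul_add_left mul_add_right)

sublocale adj: bounded_linear "adj A"
proof
  show "adj A (r *\<^sub>R x) = r *\<^sub>R adj A x" for r x
    using adj_scl[OF real_scalar] by (simp add: scl_of_real)
  show "\<exists>K. \<forall>x. norm (adj A x) \<le> norm x * K"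
    using norm_adj by (metis mult.right_neutral order_refl)
qed (simp add: adj_add)

lemma rep_diff: "\<rho> (x - y) v = \<rho> x v - \<rho> y v"
  using rep_add[of "x - y" y v] by simp

lemma norm_le_rep_adj:
  assumes "0 \<le> B" "\<And>v. norm (\<rho> (adj A x) v) \<le> B * norm v"
  shows "norm x \<le> B"
  using norm_le_rep[OF assms] by (simp add: norm_adj)

text \<open>This is the form in which positivity of \<open>x\<^sup>* x\<close> enters the estimates
  below.\<close>

lemma inner_rep_adj_mul: "\<rho> (mul A (adj A x) x) v \<bullet> v = (norm (\<rho> x v))\<^sup>2"
  by (simp add: rep_mul rep_adj adj_adj power2_norm_eq_inner)

lemma adj_adj_mul_self [simp]: "adj A (mul A (adj A x) x) = mul A (adj A x) x"
  by (simp add: adj_mul adj_adj)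

text \<open>The iteration is majorized by its scalar case \<open>h = 1\<close>, which converges monotonically; at
  \<open>norm h = 1\<close> it is no contraction.\<close>

lemma exists_one_minus_sqrt_one_minus:
  assumes "norm h \<le> 1"
  obtains u where "2 *\<^sub>R u - mul A u u = h" "norm u \<le> 1" "adj A h = h \<Longrightarrow> adj A u = u"
proof -
  define u where "u = rec_nat (0::'a) (\<lambda>_ x. (1/2) *\<^sub>R (h + mul A x x))"
  define t where "t = rec_nat (0::real) (\<lambda>_ x. (1/2) * (1 + x * x))"
  have u_Suc: "u (Suc k) = (1/2) *\<^sub>R (h + mul A (u k) (u k))" and u_0: "u 0 = 0" for k
    by (simp_all add: u_def)
  have t_Suc: "t (Suc k) = (1/2) * (1 + t k * t k)" and t_0: "t 0 = 0" for k
    by (simp_all add: t_def)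
  have t_le: "0 \<le> t k \<and> t k \<le> 1" for k
    by (induction k) (simp_all add: t_0 t_Suc mult_le_one)
  have u_le: "norm (u k) \<le> t k" for k
  proof (induction k)
    case (Suc k)
    have "norm (mul A (u k) (u k)) \<le> t k * t k"
      using norm_mul[of "u k" "u k"] mult_mono[OF Suc Suc] t_le[of k] by simp
    with norm_triangle_ineq[of h "mul A (u k) (u k)"] assms show ?case
      by (simp add: u_Suc t_Suc)
  qed (simp add: u_0 t_0)
  have step: "norm (u (Suc k) - u k) \<le> t (Suc k) - t k" for k
  proof (induction k)
    case 0
    then show ?case using assms by (simp add: u_Suc t_Suc u_0 t_0 mul.zero_left)
  next
    case (Suc k)
    let ?d = "u (Suc k) - u k" and ?e = "t (Suc k) - t k"
    \<comment> \<open>Difference of squares without commutativity: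
      \<open>x\<^sup>2 - y\<^sup>2 = x (x - y) + (x - y) y\<close>. The scalar increments satisfy
      the same identity, so the bounds match term by term.\<close>
    have "u (Suc (Suc k)) - u (Suc k) = (1/2) *\<^sub>R (mul A (u (Suc k)) ?d + mul A ?d (u k))"
      unfolding u_Suc[of "Suc k"] u_Suc[of k, THEN arg_cong[where f = "\<lambda>x. _ - x"]]
      by (simp add: u_Suc[of k] mul.diff_left mul.diff_right algebra_simps)
    also have "norm \<dots> \<le> (1/2) * (norm (mul A (u (Suc k)) ?d) + norm (mul A ?d (u k)))"
      by (simp add: norm_triangle_ineq)
    also have "\<dots> \<le> (1/2) * (t (Suc k) * ?e + ?e * t k)"
    proof -
      have "norm (mul A (u (Suc k)) ?d) \<le> t (Suc k) * ?e"
        by (rule order_trans[OF norm_mul mult_mono[OF u_le Suc]]) (use t_le in auto)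
      moreover have "norm (mul A ?d (u k)) \<le> ?e * t k"
        by (rule order_trans[OF norm_mul mult_mono[OF Suc u_le]])
          (use t_le order_trans[OF norm_ge_zero Suc] in auto)
      ultimately show ?thesis by simp
    qed
    also have "\<dots> = t (Suc (Suc k)) - t (Suc k)"
      unfolding t_Suc[of "Suc k"] t_Suc[of k, THEN arg_cong[where f = "\<lambda>x. _ - x"]]
      by (simp add: t_Suc[of k] algebra_simps)
    finally show ?case .
  qed
  \<comment> \<open>The increments of \<open>t\<close> bound norms, hence are nonnegative. As
    \<open>t\<close> stays below 1, its telescoping series converges and dominates that of
    \<open>u\<close>.\<close>
  have "incseq t"
    by (rule incseq_SucI) (use order_trans[OF norm_ge_zero step] in simp)
  then obtain l where "t \<longlonglongrightarrow> l"
    using incseq_convergent[of t 1] t_le by blast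
  then have "summable (\<lambda>k. t (Suc k) - t k)"
    by (rule telescope_summable)
  then have "summable (\<lambda>k. u (Suc k) - u k)"
    by (rule summable_comparison_test'[where N = 0]) (use step in auto)
  then have "(\<lambda>n. \<Sum>k<n. u (Suc k) - u k) \<longlonglongrightarrow> (\<Sum>k. u (Suc k) - u k)"
    by (rule summable_LIMSEQ)
  then obtain x where x: "u \<longlonglongrightarrow> x"
    unfolding sum_lessThan_telescope by (auto simp: u_0)
  have "(\<lambda>k. u (Suc k)) \<longlonglongrightarrow> (1/2) *\<^sub>R (h + mul A x x)"
    unfolding u_Suc by (intro tendsto_intros mul.tendsto x)
  then have "x = (1/2) *\<^sub>R (h + mul A x x)"
    using LIMSEQ_Suc[OF x] LIMSEQ_unique by blast
  then have "2 *\<^sub>R x = 2 *\<^sub>R ((1/2) *\<^sub>R (h + mul A x x))" by simp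
  then have "2 *\<^sub>R x - mul A x x = h" by simp
  moreover have "norm x \<le> 1"
    by (rule LIMSEQ_le_const2[OF tendsto_norm[OF x]]) (use u_le t_le order_trans in blast)
  moreover have "adj A x = x" if "adj A h = h"
  proof -
    have "adj A (u k) = u k" for k
      by (induction k) (simp_all add: u_0 u_Suc adj.zero adj.scaleR adj.add adj_mul that)
    then show ?thesis
      using LIMSEQ_unique[OF adj.tendsto[OF x]] x by simp
  qed
  ultimately show thesis using that by blast
qed

text \<open>The hypotheses say that \<open>1 - b\<^sup>* b\<close> is the square of the self-adjoint
  \<open>1 - u\<close>. On a vector \<open>v\<close> this makes the squared norm of \<open>v\<close>
  minus that of \<open>b v\<close> equal to the squared norm of \<open>v - u v\<close>.\<close>

lemma norm_le_one_if_one_minus_square: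
  assumes "mul A (adj A b) b = 2 *\<^sub>R u - mul A u u" "adj A u = u"
  shows "norm b \<le> 1"
proof (rule norm_le_rep)
  fix v
  have "(norm (\<rho> b v))\<^sup>2 = (2 *\<^sub>R \<rho> u v - \<rho> u (\<rho> u v)) \<bullet> v"
    by (simp flip: inner_rep_adj_mul add: assms rep_diff rep_scaleR rep_mul)
  also have "\<dots> = (norm v)\<^sup>2 - (norm (v - \<rho> u v))\<^sup>2"
    using assms(2) rep_adj[of u "\<rho> u v" v]
    by (simp add: power2_norm_eq_inner inner_diff_left inner_diff_right inner_commute)
  also have "\<dots> \<le> (norm v)\<^sup>2" by simp
  finally show "norm (\<rho> b v) \<le> 1 * norm v"
    by (simp add: abs_le_square_iff[symmetric])
qed simp

text \<open>For \<open>M\<close> the squared norm of \<open>w\<close> and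
  \<open>h = w\<^sup>* w\<close>, the operator \<open>h\<close> lies between 0 and \<open>M\<close>,
  so \<open>M - h\<close> has norm at most \<open>M\<close>. Passing to adjoints turns right
  multiplication by \<open>h\<close> into an action on vectors.\<close>

lemma norm_scaleR_diff_mul_le:
  "norm ((norm w)\<^sup>2 *\<^sub>R y - mul A y (mul A (adj A w) w)) \<le> (norm w)\<^sup>2 * norm y"
proof (rule norm_le_rep_adj)
  fix v
  let ?M = "(norm w)\<^sup>2" and ?h = "mul A (adj A w) w" and ?e = "\<rho> (adj A y) v"
  \<comment> \<open>This is \<open>h\<^sup>2 \<le> M h\<close>, tested on the vector
    \<open>?e\<close>.\<close>
  have 1: "(norm (\<rho> ?h ?e))\<^sup>2 \<le> ?M * (norm (\<rho> w ?e))\<^sup>2"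
    using power_mono[OF norm_rep[of "adj A w" "\<rho> w ?e"], of 2]
    by (simp add: rep_mul norm_adj power_mult_distrib)
  have "(norm (?M *\<^sub>R ?e - \<rho> ?h ?e))\<^sup>2
      = (?M * norm ?e)\<^sup>2 - 2 * ?M * (\<rho> ?h ?e \<bullet> ?e) + (norm (\<rho> ?h ?e))\<^sup>2"
    unfolding power_mult_distrib power2_norm_eq_inner
    by (simp add: inner_diff_left inner_diff_right inner_commute algebra_simps power2_eq_square)
  also have "\<dots> \<le> (?M * norm ?e)\<^sup>2"
    using order_trans[OF 1, of "2 * (?M * (norm (\<rho> w ?e))\<^sup>2)"]
    unfolding inner_rep_adj_mul by (simp add: mult.assoc)
  finally have "norm (?M *\<^sub>R ?e - \<rho> ?h ?e) \<le> ?M * norm ?e"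
    by (rule power2_le_imp_le) simp
  also have "\<dots> \<le> ?M * (norm y * norm v)"
    using norm_rep[of "adj A y" v] by (intro mult_left_mono) (simp_all add: norm_adj)
  finally show "norm (\<rho> (adj A (?M *\<^sub>R y - mul A y ?h)) v) \<le> ?M * norm y * norm v"
    by (simp add: adj.diff adj.scaleR adj_mul adj_adj rep_diff rep_scaleR rep_mul mult.assoc)
qed simp

text \<open>The operator version of \<open>2 t \<le> 1 + t\<^sup>2\<close>. Apply the adjoint
  equation \<open>(1 + w\<^sup>* w) y\<^sup>* = 2 w\<^sup>*\<close> to \<open>v\<close> and pair it
  with \<open>e = y\<^sup>* v\<close>: the squared norms of \<open>e\<close> and \<open>w e\<close>
  add up to twice the inner product of \<open>v\<close> and \<open>w e\<close>, which is at most the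
  sum of the squared norms of \<open>v\<close> and \<open>w e\<close>.\<close>

lemma norm_le_one_if_two_scaleR:
  assumes "y + mul A y (mul A (adj A w) w) = 2 *\<^sub>R w"
  shows "norm y \<le> 1"
proof (rule norm_le_rep_adj)
  fix v
  let ?h = "mul A (adj A w) w" and ?e = "\<rho> (adj A y) v"
  have "adj A y + mul A ?h (adj A y) = 2 *\<^sub>R adj A w"
    using arg_cong[OF assms, of "adj A"]
    by (simp add: adj.add adj.scaleR adj_mul adj_adj)
  from arg_cong[OF this, of "\<lambda>x. \<rho> x v \<bullet> ?e"]
  have "?e \<bullet> ?e + \<rho> ?h ?e \<bullet> ?e = 2 * (v \<bullet> \<rho> w ?e)"
    by (simp add: rep_add rep_scaleR rep_mul inner_add_left rep_adj adj_adj)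
  then have "(norm ?e)\<^sup>2 + (norm (\<rho> w ?e))\<^sup>2 = 2 * (v \<bullet> \<rho> w ?e)"
    by (simp only: inner_rep_adj_mul power2_norm_eq_inner)
  also have "\<dots> = (norm v)\<^sup>2 + (norm (\<rho> w ?e))\<^sup>2 - (norm (v - \<rho> w ?e))\<^sup>2"
    by (simp add: power2_norm_eq_inner inner_diff_left inner_diff_right inner_commute)
  finally have "(norm ?e)\<^sup>2 \<le> (norm v)\<^sup>2"
    using zero_le_power2[of "norm (v - \<rho> w ?e)"] by linarith
  then show "norm ?e \<le> 1 * norm v"
    by (simp add: abs_le_square_iff[symmetric])
qed simp

text \<open>Since \<open>1 + z\<^sup>* z \<ge> 1\<close>, right multiplication by it cannot shrink
  norms. Solutions \<open>d\<close> of \<open>d (1 + z\<^sup>* z) = x\<close> are therefore unique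
  and depend stably on \<open>x\<close>.\<close>

lemma norm_le_norm_add_mul:
  "norm d \<le> norm (d + mul A d (mul A (adj A z) z))"
proof (rule norm_le_rep_adj)
  fix v
  let ?h = "mul A (adj A z) z" and ?e = "\<rho> (adj A d) v"
  have "norm ?e * norm ?e \<le> ?e \<bullet> ?e + \<rho> ?h ?e \<bullet> ?e"
    unfolding inner_rep_adj_mul by (simp add: power2_norm_eq_inner flip: power2_eq_square)
  also have "\<dots> = (?e + \<rho> ?h ?e) \<bullet> ?e" by (simp add: inner_add_left)
  also have "\<dots> \<le> norm (?e + \<rho> ?h ?e) * norm ?e" by (rule norm_cauchy_schwarz)
  finally have "norm ?e \<le> norm (?e + \<rho> ?h ?e)"
    by (metis mult_le_cancel_right norm_ge_zero norm_le_zero_iff order_le_less not_le)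
  also have "?e + \<rho> ?h ?e = \<rho> (adj A (d + mul A d ?h)) v"
    by (simp add: adj.add adj_mul adj_adj rep_add rep_mul)
  also have "norm \<dots> \<le> norm (d + mul A d ?h) * norm v"
    using norm_rep by (metis norm_adj)
  finally show "norm ?e \<le> norm (d + mul A d ?h) * norm v" .
qed simp

text \<open>Iterating \<open>y = 2 w - y h\<close> need not converge when
  \<open>h = w\<^sup>* w\<close> is large. Adding \<open>M y\<close> to both sides, with
  \<open>M\<close> the squared norm of \<open>w\<close>, gives
  \<open>(1 + M) y = 2 w + y (M - h)\<close>, a contraction with constant \<open>M / (1 + M)\<close>
  by \<open>norm_scaleR_diff_mul_le\<close>.\<close>

lemma ex_add_mul_eq_two_scaleR:
  obtains y where "y + mul A y (mul A (adj A w) w) = 2 *\<^sub>R w"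
proof -
  let ?M = "(norm w)\<^sup>2" and ?h = "mul A (adj A w) w"
  define f where "f y = (1 / (1 + ?M)) *\<^sub>R (2 *\<^sub>R w + (?M *\<^sub>R y - mul A y ?h))" for y
  have M: "1 + ?M > 0" by (simp add: add_pos_nonneg)
  have "dist (f x) (f y) \<le> (?M / (1 + ?M)) * dist x y" for x y
  proof -
    have "f x - f y = (1 / (1 + ?M)) *\<^sub>R (?M *\<^sub>R (x - y) - mul A (x - y) ?h)"
      unfolding f_def scaleR_diff_right[symmetric]
      by (simp add: mul.diff_left algebra_simps)
    then have "norm (f x - f y) = (1 / (1 + ?M)) * norm (?M *\<^sub>R (x - y) - mul A (x - y) ?h)"
      using M by simp
    also have "\<dots> \<le> (1 / (1 + ?M)) * (?M * norm (x - y))"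
      by (intro mult_left_mono norm_scaleR_diff_mul_le) (use M in simp)
    finally show ?thesis by (simp add: dist_norm)
  qed
  moreover have "?M / (1 + ?M) < 1" using M by simp
  ultimately obtain y where "f y = y"
    using banach_fix_type[of "?M / (1 + ?M)" f] M by (auto simp: less_imp_le)
  then have "(1 + ?M) *\<^sub>R y = (1 + ?M) *\<^sub>R f y" by simp
  also have "\<dots> = 2 *\<^sub>R w + (?M *\<^sub>R y - mul A y ?h)"
    using M by (simp add: f_def)
  finally have "y + mul A y ?h = 2 *\<^sub>R w"
    by (simp add: algebra_simps)
  then show thesis by (rule that)
qed

lemma contraction_eq_two_scaleR:
  assumes "norm b \<le> 1"
  obtains z where "b + mul A b (mul A (adj A z) z) = 2 *\<^sub>R z"
proof -
  let ?h = "mul A (adj A b) b"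
  have "norm ?h \<le> 1"
    using norm_mul[of "adj A b" b] assms mult_le_one[of "norm b" "norm b"] by (simp add: norm_adj)
  then obtain u where u: "2 *\<^sub>R u - mul A u u = ?h" "norm u \<le> 1" "adj A u = u"
    by (rule exists_one_minus_sqrt_one_minus) simp
  have bound: "norm (mul A x u) \<le> norm x" for x
    using norm_mul[of x u] mult_left_mono[OF u(2), of "norm x"] by simp
  \<comment> \<open>A fixed point solves \<open>z (2 - u) = b\<close>, so that \<open>z\<close>
    plays the role of \<open>b (2 - u)\<^sup>-\<^sup>1\<close> without a unit in the
    algebra.\<close>
  define f where "f y = (1 / 2) *\<^sub>R (b + mul A y u)" for y
  have "dist (f x) (f y) \<le> (1 / 2) * dist x y" for x y
  proof -
    have "f x - f y = (1 / 2) *\<^sub>R mul A (x - y) u"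
      unfolding f_def by (simp add: mul.diff_left algebra_simps)
    then show ?thesis using bound[of "x - y"] by (simp add: dist_norm)
  qed
  then obtain z where "f z = z"
    using banach_fix_type[of "1/2" f] by auto
  then have "2 *\<^sub>R f z = 2 *\<^sub>R z" by simp
  then have z: "b = 2 *\<^sub>R z - mul A z u" by (simp add: f_def algebra_simps)
  let ?k = "mul A (adj A z) z"
  \<comment> \<open>Formally \<open>d = (2 - u) z\<^sup>* z - u\<close>. Both
    \<open>(2 - u) z\<^sup>* z (2 - u)\<close> and \<open>u (2 - u)\<close> equal
    \<open>b\<^sup>* b\<close>, so \<open>d (2 - u) = 0\<close>, and the bound 1 on the norm of
    \<open>u\<close> forces \<open>d = 0\<close>. The equation sought is then
    \<open>z (2 - u) (1 + z\<^sup>* z) = 2 z + z d\<close>.\<close>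
  define d where "d = 2 *\<^sub>R ?k - mul A u ?k - u"
  have "2 *\<^sub>R d - mul A d u = 0"
  proof -
    have adj_b: "adj A b = 2 *\<^sub>R adj A z - mul A u (adj A z)"
      using u(3) by (subst z) (simp add: adj.diff adj.scaleR adj_mul)
    then have "?h = 2 *\<^sub>R (2 *\<^sub>R ?k - mul A u ?k) - mul A (2 *\<^sub>R ?k - mul A u ?k) u"
      unfolding arg_cong2[OF adj_b z, of "mul A"]
      by (simp add: mul.diff_left mul.diff_right mul.scaleR_left mul.scaleR_right mul_assoc algebra_simps)
    then show ?thesis using u(1)
      by (simp add: d_def mul.diff_left mul.add_left mul.scaleR_left algebra_simps)
  qed
  then have "2 * norm d \<le> norm d" using bound[of d] by (metis eq_iff_diff_eq_0 norm_scaleR abs_numeral)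
  then have "d = 0" by simp
  have "b + mul A b ?k = 2 *\<^sub>R z + mul A z d"
    by (subst (1 2) z)
      (simp add: d_def mul.diff_left mul.diff_right mul.add_right mul.scaleR_left mul.scaleR_right
        mul_assoc algebra_simps)
  then show thesis using \<open>d = 0\<close> that by (simp add: mul.zero_right)
qed

end

section \<open>From operator algebras over \<open>K\<close> to real representations\<close>

lemma cstar_algebra_represented:
  fixes A :: "'a::banach star_algebra"
  assumes "cstar_algebra TYPE('h::{real_inner,banach}) K A" and "\<real> \<subseteq> K"
  obtains \<rho> :: "'a \<Rightarrow> 'h::{real_inner,banach} \<Rightarrow> 'h" where "represented_star_algebra K A \<rho>"
proof -
  obtain H :: "'h hilbert_structure" and \<sigma> where
    "banach_star_algebra K A" and H: "hilbert_space K H"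
    and \<sigma>: "star_representation K A H \<sigma>" and iso: "\<And>x. norm (\<sigma> x) = norm x"
    using assms(1) unfolding cstar_algebra_def by blast
  interpret banach_star_algebra K A by fact
  interpret hilbert_space K H by fact
  have real_scalar: "complex_of_real r \<in> K" for r
    using assms(2) by (auto simp: Reals_def)
  have hip_add_right: "hip H z (x + y) = hip H z x + hip H z y" for x y z
    using hip_sym[of z "x + y"] hip_sym[of z] by (simp add: hip_add)
  \<comment> \<open>Polarization: the real part of \<open>hip H\<close> and the inner product of the
    type are symmetric real bilinear forms with the same norm.\<close>
  have Re_hip: "Re (hip H x y) = x \<bullet> y" for x y
  proof -
    have *: "Re (hip H v v) = v \<bullet> v" for v
      by (simp add: hip_self power2_norm_eq_inner)
    have "Re (hip H y x) = Re (hip H x y)" by (simp add: hip_sym[of y x])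
    then show ?thesis
      using *[of "x + y"] *[of x] *[of y]
      by (simp add: hip_add hip_add_right inner_add_left inner_add_right inner_commute)
  qed
  have "represented_star_algebra K A (\<lambda>x. blinfun_apply (\<sigma> x))"
  proof
    show "blinfun_apply (\<sigma> (r *\<^sub>R x)) v = r *\<^sub>R blinfun_apply (\<sigma> x) v" for r x v
      using \<sigma> real_scalar[of r] hscl_of_real[of r] scl_of_real[of r]
      unfolding star_representation_def by metis
    show "blinfun_apply (\<sigma> x) u \<bullet> v = u \<bullet> blinfun_apply (\<sigma> (adj A x)) v" for x u v
      using \<sigma> unfolding star_representation_def is_adjoint_def by (metis Re_hip)
    show "norm (blinfun_apply (\<sigma> x) v) \<le> norm x * norm v" for x v
      using norm_blinfun[of "\<sigma> x" v] by (simp add: iso)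
    show "norm x \<le> B" if "0 \<le> B" "\<And>v. norm (blinfun_apply (\<sigma> x) v) \<le> B * norm v" for B x
      using norm_blinfun_bound[OF that] by (simp add: iso)
  qed (use \<sigma> real_scalar in \<open>simp_all add: star_representation_def blinfun.add_left\<close>)
  then show thesis by (rule that)
qed

section \<open>*-homomorphisms: contractivity, lifting, distance to the kernel\<close>

locale represented_star_hom =
  F: represented_star_algebra K F \<sigma> + A: represented_star_algebra K A \<rho>
  for K :: "complex set" and F :: "'f::banach star_algebra" and \<sigma> :: "'f \<Rightarrow> 'k::real_inner \<Rightarrow> 'k"
    and A :: "'a::banach star_algebra" and \<rho> :: "'a \<Rightarrow> 'h::real_inner \<Rightarrow> 'h" +
  fixes \<pi> :: "'f \<Rightarrow> 'a"
  assumes star_hom: "star_hom K F A \<pi>"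
begin

lemma hom_add: "\<pi> (x + y) = \<pi> x + \<pi> y"
  and hom_scl: "q \<in> K \<Longrightarrow> \<pi> (scl F q x) = scl A q (\<pi> x)"
  and hom_mul: "\<pi> (mul F x y) = mul A (\<pi> x) (\<pi> y)"
  and hom_adj: "\<pi> (adj F x) = adj A (\<pi> x)"
  using star_hom unfolding star_hom_def by auto

lemma hom_scaleR: "\<pi> (r *\<^sub>R x) = r *\<^sub>R \<pi> x"
  using hom_scl[OF F.real_scalar, of r x] by (simp add: F.scl_of_real A.scl_of_real)

text \<open>Contractivity is algebraic here. If \<open>x\<close> lies in the unit ball,
  \<open>x\<^sup>* x = 2 u - u\<^sup>2\<close> has a self-adjoint solution \<open>u\<close>; the map
  \<open>\<pi>\<close> carries the equation to \<open>A\<close>, where it bounds the norm of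
  \<open>\<pi> x\<close> by 1. Continuity of \<open>\<pi>\<close> is a consequence.\<close>

lemma norm_hom_le: "norm (\<pi> x) \<le> norm x"
proof (cases "x = 0")
  case True
  then show ?thesis using hom_scaleR[of 0 x] by simp
next
  case False
  have unit: "norm (\<pi> x) \<le> 1" if "norm x \<le> 1" for x
  proof -
    have "norm (mul F (adj F x) x) \<le> 1"
      using F.norm_mul[of "adj F x" x] mult_le_one[OF that _ that] by (simp add: F.norm_adj)
    then obtain u where u: "2 *\<^sub>R u - mul F u u = mul F (adj F x) x" "adj F u = u"
      by (rule F.exists_one_minus_sqrt_one_minus) simp
    have "mul F (adj F x) x + mul F u u = 2 *\<^sub>R u" using u(1) by (simp add: algebra_simps)
    from arg_cong[OF this, of \<pi>]
    have "mul A (adj A (\<pi> x)) (\<pi> x) = 2 *\<^sub>R \<pi> u - mul A (\<pi> u) (\<pi> u)"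
      by (simp add: hom_add hom_mul hom_adj hom_scaleR algebra_simps)
    moreover have "adj A (\<pi> u) = \<pi> u" using u(2) by (simp flip: hom_adj)
    ultimately show ?thesis by (rule A.norm_le_one_if_one_minus_square)
  qed
  show ?thesis
    using unit[of "(1 / norm x) *\<^sub>R x"] False by (simp add: hom_scaleR field_simps)
qed

sublocale hom: bounded_linear \<pi>
  by (rule bounded_linear_intro[where K = 1]) (simp_all add: hom_add hom_scaleR norm_hom_le)

lemma closed_star_subalgebra_closure_range: "closed_star_subalgebra K A (closure (range \<pi>))"
proof -
  have cont1: "g x \<in> closure (range \<pi>)"
    if "continuous_on UNIV g" "\<And>y. g (\<pi> y) \<in> range \<pi>" "x \<in> closure (range \<pi>)" for g x
  proof -
    have "g ` closure (range \<pi>) \<subseteq> closure (range \<pi>)"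
      by (rule image_closure_subset)
        (use that closure_subset in \<open>auto intro: continuous_on_subset\<close>)
    then show ?thesis using that by blast
  qed
  \<comment> \<open>Separate continuity suffices: first the second argument is moved to the closure
    with the first one in the range, then the first argument follows.\<close>
  have cont2: "g x y \<in> closure (range \<pi>)"
    if "\<And>x. continuous_on UNIV (g x)" "\<And>y. continuous_on UNIV (\<lambda>x. g x y)"
      "\<And>x y. g (\<pi> x) (\<pi> y) \<in> range \<pi>"
      "x \<in> closure (range \<pi>)" "y \<in> closure (range \<pi>)" for g x y
  proof -
    have "g (\<pi> x') y \<in> closure (range \<pi>)" for x'
      using cont1[of "g (\<pi> x')" y] that by auto
    then have "(\<lambda>x. g x y) ` closure (range \<pi>) \<subseteq> closure (range \<pi>)"
      by (intro image_closure_subset) (use that in \<open>auto intro: continuous_on_subset\<close>)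
    then show ?thesis using that by blast
  qed
  have "x + y \<in> closure (range \<pi>)" if "x \<in> closure (range \<pi>)" "y \<in> closure (range \<pi>)" for x y
    by (rule cont2[of "(+)"]) (use that in \<open>simp_all add: continuous_on_add flip: hom_add\<close>)
  moreover have "mul A x y \<in> closure (range \<pi>)"
    if "x \<in> closure (range \<pi>)" "y \<in> closure (range \<pi>)" for x y
    by (rule cont2[of "mul A"])
      (use that in \<open>simp_all add: linear_continuous_on A.mul.bounded_linear_left
        A.mul.bounded_linear_right flip: hom_mul\<close>)
  moreover have "adj A x \<in> closure (range \<pi>)" if "x \<in> closure (range \<pi>)" for x
    by (rule cont1[of "adj A"])
      (use that in \<open>simp_all add: linear_continuous_on A.adj.bounded_linear_axioms flip: hom_adj\<close>)
  moreover have "scl A q x \<in> closure (range \<pi>)" if "q \<in> K" "x \<in> closure (range \<pi>)" for q x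
  proof (rule cont1[of "scl A q"])
    have "bounded_linear (scl A q)"
    proof (rule bounded_linear_intro)
      show "scl A q (r *\<^sub>R y) = r *\<^sub>R scl A q y" for r y
        using A.scl_scl[OF \<open>q \<in> K\<close> A.real_scalar, of r y] A.scl_scl[OF A.real_scalar \<open>q \<in> K\<close>, of r y]
        by (simp add: A.scl_of_real mult.commute)
      show "norm (scl A q y) \<le> norm y * cmod q" for y
        using that by (simp add: A.norm_scl)
    qed (use that in \<open>simp add: A.scl_add_right\<close>)
    then show "continuous_on UNIV (scl A q)" by (rule linear_continuous_on)
  qed (use that in \<open>simp_all flip: hom_scl\<close>)
  moreover have "0 \<in> closure (range \<pi>)"
    using closure_subset[of "range \<pi>"] hom.zero by (metis rangeI subsetD)
  ultimately show ?thesis unfolding closed_star_subalgebra_def by simp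
qed

text \<open>The solution \<open>y\<close> of the equation for \<open>w\<close> in \<open>F\<close>
  is mapped to a solution of the equation for \<open>\<pi> w\<close> in \<open>A\<close>, and
  \<open>b\<close> is the only such solution.\<close>

lemma lift_of_solution:
  assumes "b + mul A b (mul A (adj A (\<pi> w)) (\<pi> w)) = 2 *\<^sub>R \<pi> w"
  obtains y where "norm y \<le> 1" "\<pi> y = b"
proof -
  obtain y where y: "y + mul F y (mul F (adj F w) w) = 2 *\<^sub>R w"
    by (rule F.ex_add_mul_eq_two_scaleR)
  have "\<pi> y + mul A (\<pi> y) (mul A (adj A (\<pi> w)) (\<pi> w)) = 2 *\<^sub>R \<pi> w"
    using arg_cong[OF y, of \<pi>] by (simp add: hom_add hom_mul hom_adj hom_scaleR)
  then have "(\<pi> y - b) + mul A (\<pi> y - b) (mul A (adj A (\<pi> w)) (\<pi> w)) = 0"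
    using assms by (simp add: A.mul.diff_left algebra_simps)
  then have "\<pi> y = b"
    using A.norm_le_norm_add_mul[of "\<pi> y - b" "\<pi> w"] by simp
  with F.norm_le_one_if_two_scaleR[OF y] that show thesis by blast
qed

lemma unit_ball_dense:
  assumes dense: "closure (range \<pi>) = UNIV" and "norm b \<le> 1" "0 < e"
  obtains y where "norm y \<le> 1" "norm (b - \<pi> y) < e"
proof -
  let ?sq = "\<lambda>z. mul A (adj A z) z"
  obtain z where z: "b + mul A b (?sq z) = 2 *\<^sub>R z"
    by (rule A.contraction_eq_two_scaleR[OF assms(2)])
  define g where "g z' = 2 *\<^sub>R (z - z') + mul A b (?sq z' - ?sq z)" for z'
  \<comment> \<open>\<open>G (\<pi> w)\<close> bounds the right-hand side of the error equation
    below, using that \<open>\<pi> y\<close> has norm at most 1. It is continuous and vanishes at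
    \<open>z\<close>, so density of the range makes it small. No bound on the norm of
    \<open>w\<close> is needed.\<close>
  define G where "G z' = 2 * norm (z - z') + norm (?sq z' - ?sq z)" for z'
  have "continuous_on UNIV G"
    unfolding G_def by (intro continuous_intros A.mul.continuous_on A.adj.continuous_on)
  then have "open (G -` {..<e})" by (simp add: continuous_on_open_vimage)
  moreover have "z \<in> G -` {..<e}" using \<open>0 < e\<close> by (simp add: G_def)
  ultimately obtain w where w: "G (\<pi> w) < e"
    using dense open_Int_closure_eq_empty[of "G -` {..<e}" "range \<pi>"] by auto
  obtain y where y: "y + mul F y (mul F (adj F w) w) = 2 *\<^sub>R w"
    by (rule F.ex_add_mul_eq_two_scaleR)
  have "norm y \<le> 1" by (rule F.norm_le_one_if_two_scaleR[OF y])
  have "\<pi> y + mul A (\<pi> y) (?sq (\<pi> w)) = 2 *\<^sub>R \<pi> w"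
    using arg_cong[OF y, of \<pi>] by (simp add: hom_add hom_mul hom_adj hom_scaleR)
  \<comment> \<open>The equations for \<open>b\<close> and \<open>\<pi> y\<close> have different
    coefficients; both are written with the coefficient of \<open>z\<close>, and the discrepancy
    goes to the right.\<close>
  then have "(b - \<pi> y) + mul A (b - \<pi> y) (?sq z)
      = 2 *\<^sub>R (z - \<pi> w) + mul A (\<pi> y) (?sq (\<pi> w) - ?sq z)"
    using z by (simp add: A.mul.diff_left A.mul.diff_right algebra_simps)
  then have "norm (b - \<pi> y) \<le> norm (2 *\<^sub>R (z - \<pi> w) + mul A (\<pi> y) (?sq (\<pi> w) - ?sq z))"
    using A.norm_le_norm_add_mul[of "b - \<pi> y" z] by simp
  also have "\<dots> \<le> 2 * norm (z - \<pi> w) + norm (mul A (\<pi> y) (?sq (\<pi> w) - ?sq z))"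
    using norm_triangle_ineq[of "2 *\<^sub>R (z - \<pi> w)"] by simp
  also have "\<dots> \<le> G (\<pi> w)"
    using order_trans[OF A.norm_mul mult_right_mono[of "norm (\<pi> y)" 1]]
      order_trans[OF norm_hom_le \<open>norm y \<le> 1\<close>]
    by (simp add: G_def)
  finally show thesis using w \<open>norm y \<le> 1\<close> that by simp
qed

text \<open>Successive approximation: an error of norm at most \<open>(1/2)^k\<close> is halved by
  subtracting the image of an element of norm at most \<open>(1/2)^k\<close>. The corrections are
  summable in the complete space \<open>F\<close>.\<close>

lemma surj_hom:
  assumes dense: "closure (range \<pi>) = UNIV"
  shows "surj \<pi>"
proof -
  have approx: "\<exists>y. norm y \<le> (1/2)^k \<and> norm (b - \<pi> y) \<le> (1/2)^Suc k"
    if "norm b \<le> (1/2)^k" for b k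
  proof -
    have "norm (2^k *\<^sub>R b) \<le> 1" using that by (simp add: power_divide field_simps)
    then obtain y where y: "norm y \<le> 1" "norm (2^k *\<^sub>R b - \<pi> y) < 1/2"
      by (rule unit_ball_dense[OF dense, where e = "1/2"]) auto
    have "b - \<pi> ((1/2)^k *\<^sub>R y) = (1/2)^k *\<^sub>R (2^k *\<^sub>R b - \<pi> y)"
      by (simp add: hom_scaleR scaleR_diff_right power_divide)
    then have "norm (b - \<pi> ((1/2)^k *\<^sub>R y)) \<le> (1/2)^Suc k"
      using y(2) by (simp add: power_divide divide_simps)
    moreover have "norm ((1/2)^k *\<^sub>R y) \<le> (1/2)^k"
      using y(1) by (simp add: field_simps)
    ultimately show ?thesis by blast
  qed
  have unit: "b \<in> range \<pi>" if "norm b \<le> 1" for b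
  proof -
    define y where "y k r = (SOME y. norm y \<le> (1/2)^k \<and> norm (r - \<pi> y) \<le> (1/2)^Suc k)" for k r
    define r where "r = rec_nat b (\<lambda>k r. r - \<pi> (y k r))"
    have r_Suc: "r (Suc k) = r k - \<pi> (y k (r k))" and r_0: "r 0 = b" for k
      by (simp_all add: r_def)
    have step: "norm (y k r) \<le> (1/2)^k" "norm (r - \<pi> (y k r)) \<le> (1/2)^Suc k"
      if "norm r \<le> (1/2)^k" for k r
      using someI_ex[OF approx[OF that]] unfolding y_def by blast+
    have r_le: "norm (r k) \<le> (1/2)^k" for k
      by (induction k) (use that step(2) in \<open>simp_all only: r_0 r_Suc power_0\<close>)
    have "summable (\<lambda>k. (1/2)^k :: real)" by simp
    then have "summable (\<lambda>k. y k (r k))"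
      by (rule summable_comparison_test'[where N = 0]) (use step(1)[OF r_le] in simp)
    then have "(\<lambda>n. \<Sum>k<n. y k (r k)) \<longlonglongrightarrow> (\<Sum>k. y k (r k))"
      by (rule summable_LIMSEQ)
    then have "(\<lambda>n. \<pi> (\<Sum>k<n. y k (r k))) \<longlonglongrightarrow> \<pi> (\<Sum>k. y k (r k))"
      by (rule hom.tendsto)
    moreover have "\<pi> (\<Sum>k<n. y k (r k)) = b - r n" for n
      by (induction n) (simp_all add: r_0 r_Suc hom_add hom.zero)
    moreover have "r \<longlonglongrightarrow> 0"
      by (rule Lim_null_comparison[where g = "\<lambda>k. (1/2)^k"])
        (use r_le in \<open>auto intro!: LIMSEQ_realpow_zero\<close>)
    ultimately have "\<pi> (\<Sum>k. y k (r k)) = b"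
      using LIMSEQ_unique tendsto_diff[OF tendsto_const[of b] \<open>r \<longlonglongrightarrow> 0\<close>] by fastforce
    then show ?thesis by blast
  qed
  have "b \<in> range \<pi>" for b
  proof (cases "b = 0")
    case True
    then show ?thesis using hom.zero by (metis rangeI)
  next
    case False
    then obtain y where "(1 / norm b) *\<^sub>R b = \<pi> y" using unit[of "(1 / norm b) *\<^sub>R b"] by auto
    from arg_cong[OF this, of "\<lambda>x. norm b *\<^sub>R x"] have "b = \<pi> (norm b *\<^sub>R y)"
      using False by (simp add: hom_scaleR)
    then show ?thesis by blast
  qed
  then show ?thesis by blast
qed

text \<open>By surjectivity the auxiliary \<open>z\<close> has an exact preimage, so the lift is
  exact as well; scaling reduces to the unit ball.\<close>

lemma ex_lift_norm_le:
  assumes dense: "closure (range \<pi>) = UNIV"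
  obtains y where "\<pi> y = b" "norm y \<le> norm b"
proof (cases "b = 0")
  case True
  then show ?thesis using that[of 0] by (simp add: hom.zero)
next
  case False
  then have "norm ((1 / norm b) *\<^sub>R b) \<le> 1" by simp
  then obtain z where z: "(1 / norm b) *\<^sub>R b + mul A ((1 / norm b) *\<^sub>R b) (mul A (adj A z) z) = 2 *\<^sub>R z"
    by (rule A.contraction_eq_two_scaleR)
  obtain w where "z = \<pi> w" using surj_hom[OF dense] by blast
  with z obtain y where "norm y \<le> 1" "\<pi> y = (1 / norm b) *\<^sub>R b"
    using lift_of_solution by metis
  then show ?thesis
    using that[of "norm b *\<^sub>R y"] False mult_left_mono[of "norm y" 1 "norm b"] by (simp add: hom_scaleR)
qed

text \<open>The distance from \<open>x\<close> to the kernel is the norm of \<open>\<pi> x\<close>,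
  and it is attained at \<open>x - y\<close> for a norm-preserving lift \<open>y\<close> of
  \<open>\<pi> x\<close>. Attainment is what settles the closed ball whose radius equals the
  distance.\<close>

lemma ball_meets_kernel_iff:
  assumes dense: "closure (range \<pi>) = UNIV"
  shows "ball x r \<inter> {z. \<pi> z = 0} \<noteq> {} \<longleftrightarrow> norm (\<pi> x) < r"
    and "cball x r \<inter> {z. \<pi> z = 0} = {} \<longleftrightarrow> r < norm (\<pi> x)"
proof -
  obtain y where y: "\<pi> y = \<pi> x" "norm y \<le> norm (\<pi> x)" by (rule ex_lift_norm_le[OF dense])
  have near: "\<pi> (x - y) = 0" "dist x (x - y) \<le> norm (\<pi> x)"
    using y by (simp_all add: hom.diff dist_norm)
  have far: "norm (\<pi> x) \<le> dist x z" if "\<pi> z = 0" for z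
    using norm_hom_le[of "x - z"] that by (simp add: hom.diff dist_norm)
  show "ball x r \<inter> {z. \<pi> z = 0} \<noteq> {} \<longleftrightarrow> norm (\<pi> x) < r"
    using near far by (force simp: disjoint_iff)
  show "cball x r \<inter> {z. \<pi> z = 0} = {} \<longleftrightarrow> r < norm (\<pi> x)"
    using near far by (force simp: disjoint_iff)
qed

lemma closed_kernel: "closed {z. \<pi> z = 0}"
  by (intro closed_Collect_eq hom.continuous_on continuous_intros)

lemma hom_word_value:
  assumes "\<And>l. l \<in> set w \<Longrightarrow> \<pi> (c (case_sum id id l)) = a (case_sum id id l)"
  shows "\<pi> (word_value F c w) = word_value A a w"
  using assms
proof (induction w rule: induct_list012)
  case 1
  then show ?case by (simp add: hom.zero)
next
  case (2 l)
  then show ?case by (cases l) (simp_all add: hom_adj)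
next
  case (3 l l' w)
  have "\<pi> (letter_value F c l) = letter_value A a l"
    using "3.prems"[of l] by (cases l) (simp_all add: hom_adj)
  with 3 show ?case by (simp add: hom_mul)
qed

lemma hom_point:
  assumes "\<And>j. enat j < n \<Longrightarrow> \<pi> (c j) = a j" and "p \<in> rational_polynomials K n"
  shows "\<pi> (point F c p) = point A a p"
proof -
  have "\<pi> (scl F q (word_value F c w)) = scl A q (word_value A a w)" if "(q, w) \<in> set p" for q w
    using assms that hom_word_value[of w c a] by (force simp: rational_polynomials_def hom_scl)
  moreover have "\<pi> (sum_list (map f p)) = sum_list (map (\<lambda>t. \<pi> (f t)) p)"
    for f and p :: star_polynomial
    by (induction p) (simp_all add: hom.zero hom_add)
  ultimately show ?thesis
    unfolding point_def by (auto intro!: arg_cong[where f = sum_list] map_cong)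
qed

end

lemma ex1_implies_unique: "\<exists>!x. P x \<Longrightarrow> P x \<Longrightarrow> P y \<Longrightarrow> x = y"
  by blast

text \<open>The universal property speaks of concrete operator algebras, so it is applied to the
  image of \<open>A\<close> under its isometric representation \<open>\<rho>\<close> and pulled back
  along \<open>\<rho>\<close>.\<close>

lemma ex1_star_hom:
  fixes A :: "'a::banach star_algebra" and F :: "'f::banach star_algebra"
  assumes "cstar_algebra TYPE('h::{real_inner,banach}) K A"
    and a: "\<And>j. enat j < n \<Longrightarrow> norm (a j) \<le> 1"
    and univ: "universal_property TYPE('h) K n F c"
  shows "\<exists>!\<pi>. star_hom K F A \<pi> \<and> (\<forall>j. enat j < n \<longrightarrow> \<pi> (c j) = a j)"
proof -
  obtain H :: "'h hilbert_structure" and S \<rho> where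
    "banach_star_algebra K A" and H: "hilbert_space K H"
    and S: "concrete_cstar_algebra K H S" "range \<rho> = S"
    and rep: "star_representation K A H \<rho>" and iso: "\<And>x. norm (\<rho> x) = norm x"
    using assms(1) unfolding cstar_algebra_def by blast
  interpret A: banach_star_algebra K A by fact
  interpret H: hilbert_space K H by fact
  have \<rho>_add: "\<rho> (x + y) = \<rho> x + \<rho> y" for x y
    using rep unfolding star_representation_def by blast
  have inj: "x = y" if "\<rho> x = \<rho> y" for x y
    using iso[of "x - y"] \<rho>_add[of "x - y" y] that by simp
  \<comment> \<open>Representations relate adjoints only through \<open>is_adjoint\<close>;
    uniqueness turns this into the equation needed for \<open>\<pi>\<close> to commute with
    \<open>adj\<close>.\<close>
  have is_adjoint_unique: "T = U" if "is_adjoint H V T" "is_adjoint H V U" for V T U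
  proof (rule blinfun_eqI)
    fix v
    let ?d = "blinfun_apply T v - blinfun_apply U v"
    have "hip H ?d (blinfun_apply T v) = hip H ?d (blinfun_apply U v)"
      using that unfolding is_adjoint_def by metis
    then have "hip H (blinfun_apply T v) ?d = hip H (blinfun_apply U v) ?d"
      using H.hip_sym by metis
    then have "hip H ?d ?d = 0"
      using H.hip_add[of "?d" "blinfun_apply U v" ?d] by simp
    then show "blinfun_apply T v = blinfun_apply U v"
      by (simp add: H.hip_self)
  qed
  have uni: "\<exists>!\<phi>. star_representation K F H \<phi> \<and> range \<phi> \<subseteq> S \<and> (\<forall>j. enat j < n \<longrightarrow> \<phi> (c j) = \<rho> (a j))"
    using univ[unfolded universal_property_def, rule_format, of H S "\<lambda>j. \<rho> (a j)"] H S a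
    by (auto simp: iso)
  then obtain \<phi> where \<phi>: "star_representation K F H \<phi>" "range \<phi> \<subseteq> S"
      "\<And>j. enat j < n \<Longrightarrow> \<phi> (c j) = \<rho> (a j)"
    by blast
  define \<pi> where "\<pi> x = inv \<rho> (\<phi> x)" for x
  have \<rho>\<pi>: "\<rho> (\<pi> x) = \<phi> x" for x
    unfolding \<pi>_def using \<phi>(2) S(2) by (intro f_inv_into_f) auto
  have "star_hom K F A \<pi>"
    unfolding star_hom_def
  proof (intro conjI allI ballI)
    show "\<pi> (x + y) = \<pi> x + \<pi> y" for x y
      by (rule inj) (use \<phi>(1) in \<open>simp add: \<rho>_add \<rho>\<pi> star_representation_def\<close>)
    show "\<pi> (mul F x y) = mul A (\<pi> x) (\<pi> y)" for x y
      by (rule inj) (use \<phi>(1) rep in \<open>simp add: \<rho>\<pi> star_representation_def\<close>)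
    show "\<pi> (scl F q x) = scl A q (\<pi> x)" if "q \<in> K" for q x
      by (rule inj, rule blinfun_eqI)
        (use \<phi>(1) rep that in \<open>simp add: \<rho>\<pi> star_representation_def\<close>)
    show "\<pi> (adj F x) = adj A (\<pi> x)" for x
    proof (rule inj, rule is_adjoint_unique)
      show "is_adjoint H (\<phi> x) (\<rho> (\<pi> (adj F x)))"
        using \<phi>(1) by (simp add: \<rho>\<pi> star_representation_def)
      show "is_adjoint H (\<phi> x) (\<rho> (adj A (\<pi> x)))"
        using rep unfolding star_representation_def by (metis \<rho>\<pi>)
    qed
  qed
  moreover have "\<pi> (c j) = a j" if "enat j < n" for j
    by (rule inj) (simp add: \<rho>\<pi> \<phi>(3)[OF that])
  moreover have "\<psi> = \<pi>" if \<psi>: "star_hom K F A \<psi>" "\<forall>j. enat j < n \<longrightarrow> \<psi> (c j) = a j" for \<psi>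
  proof -
    have "star_representation K F H (\<lambda>x. \<rho> (\<psi> x))"
      using rep \<psi>(1) S(1) unfolding star_representation_def star_hom_def by auto
    moreover have "range (\<lambda>x. \<rho> (\<psi> x)) \<subseteq> S" using S(2) by blast
    ultimately have "(\<lambda>x. \<rho> (\<psi> x)) = \<phi>"
      using \<phi> \<psi>(2) by (intro ex1_implies_unique[OF uni]) auto
    then have "\<rho> (\<psi> x) = \<rho> (\<pi> x)" for x using fun_cong \<rho>\<pi> by fastforce
    then show ?thesis using inj by blast
  qed
  ultimately show ?thesis by blast
qed

section \<open>Recursive functions and c.e. sets\<close>

lemma arg_simps [simp]:
  "arg (x # xs) 0 = x" "arg (x # xs) (Suc i) = arg xs i" "arg [] i = 0"
  "arg (tl xs) i = arg xs (Suc i)" "arg (drop k xs) i = arg xs (k + i)"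
  by (cases xs; simp add: arg_def add.commute less_diff_conv)+

text \<open>Arities are not tracked, yet \<open>comp\<close> takes only finitely many inner
  functions. As only finitely many arguments are read, \<open>partial_recursive_subst\<close> can
  feed an arbitrary list of arguments through \<open>comp\<close>.\<close>

lemma partial_recursive_finite_support:
  assumes "partial_recursive f"
  shows "\<exists>N. \<forall>xs ys. (\<forall>i<N. arg xs i = arg ys i) \<longrightarrow> f xs = f ys"
  using assms
proof induction
  case zero
  then show ?case by simp
next
  case succ
  then show ?case by (intro exI[of _ 1]) simp
next
  case (proj i)
  then show ?case by (intro exI[of _ "Suc i"]) simp
next
  case (comp f gs)
  then obtain N where N: "\<And>g xs ys. g \<in> set gs \<Longrightarrow> \<forall>i<N g. arg xs i = arg ys i \<Longrightarrow> g xs = g ys"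
    by metis
  have "map (\<lambda>g. g xs) gs = map (\<lambda>g. g ys) gs"
    if "\<forall>i<Max (N ` set gs). arg xs i = arg ys i" for xs ys
  proof (rule map_cong[OF refl])
    fix g assume "g \<in> set gs"
    then have "N g \<le> Max (N ` set gs)" by simp
    with that show "g xs = g ys" by (intro N[OF \<open>g \<in> set gs\<close>]) auto
  qed
  then show ?case by metis
next
  case (prim f g)
  then obtain M N where M: "\<And>xs ys. \<forall>i<M. arg xs i = arg ys i \<Longrightarrow> f xs = f ys"
    and N: "\<And>xs ys. \<forall>i<N. arg xs i = arg ys i \<Longrightarrow> g xs = g ys"
    by metis
  show ?case
  proof (intro exI allI impI)
    fix xs ys assume *: "\<forall>i<Suc (M + N). arg xs i = arg ys i"
    have "f (tl xs) = f (tl ys)" by (rule M) (use * in simp)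
    moreover have "g (k # y # tl xs) = g (k # y # tl ys)" for k y
    proof (rule N, intro allI impI)
      fix i assume "i < N"
      with * show "arg (k # y # tl xs) i = arg (k # y # tl ys) i"
        by (cases i; cases "i - 1") auto
    qed
    moreover have "arg xs 0 = arg ys 0" using * by simp
    ultimately show "rec_nat (f (tl xs)) (\<lambda>k r. Option.bind r (\<lambda>y. g (k # y # tl xs))) (arg xs 0)
        = rec_nat (f (tl ys)) (\<lambda>k r. Option.bind r (\<lambda>y. g (k # y # tl ys))) (arg ys 0)"
      by simp
  qed
next
  case (mini f)
  then obtain N where N: "\<And>xs ys. \<forall>i<N. arg xs i = arg ys i \<Longrightarrow> f xs = f ys"
    by metis
  show ?case
  proof (intro exI allI impI)
    fix xs ys assume *: "\<forall>i<N. arg xs i = arg ys i"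
    have "f (k # xs) = f (k # ys)" for k
    proof (rule N, intro allI impI)
      fix i assume "i < N"
      with * show "arg (k # xs) i = arg (k # ys) i" by (cases i) auto
    qed
    then show "minimize (\<lambda>k. f (k # xs)) = minimize (\<lambda>k. f (k # ys))" by presburger
  qed
qed

section \<open>Closure properties of total recursive functions and decidable predicates\<close>

definition total_recursive :: "(nat list \<Rightarrow> nat) \<Rightarrow> bool" where
  "total_recursive g \<longleftrightarrow> partial_recursive (\<lambda>xs. Some (g xs))"

definition recursive_pred :: "(nat list \<Rightarrow> bool) \<Rightarrow> bool" where
  "recursive_pred P \<longleftrightarrow> total_recursive (\<lambda>xs. of_bool (P xs))"

named_theorems recursive

lemma total_recursive_arg [recursive]: "total_recursive (\<lambda>xs. arg xs i)"
  unfolding total_recursive_def by (rule proj)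

lemma partial_recursive_subst:
  assumes "partial_recursive f" and h: "\<And>i. total_recursive (\<lambda>xs. arg (h xs) i)"
  shows "partial_recursive (\<lambda>xs. f (h xs))"
proof -
  obtain N where N: "\<And>xs ys. \<forall>i<N. arg xs i = arg ys i \<Longrightarrow> f xs = f ys"
    using partial_recursive_finite_support[OF assms(1)] by blast
  let ?gs = "map (\<lambda>i xs. Some (arg (h xs) i)) [0..<N]"
  have "those (map (\<lambda>i. Some (k i)) js) = Some (map k js)" for k :: "nat \<Rightarrow> nat" and js :: "nat list"
    by (induction js) simp_all
  then have "those (map (\<lambda>g. g xs) ?gs) = Some (map (\<lambda>i. arg (h xs) i) [0..<N])" for xs
    by (simp add: comp_def)
  moreover have "f (map (\<lambda>i. arg (h xs) i) [0..<N]) = f (h xs)" for xs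
    by (rule N) (simp add: arg_def)
  moreover have "partial_recursive (\<lambda>xs. Option.bind (those (map (\<lambda>g. g xs) ?gs)) f)"
    using h by (intro comp assms(1)) (auto simp: total_recursive_def)
  ultimately show ?thesis by simp
qed

lemma total_recursive_subst:
  assumes "total_recursive f" and "\<And>i. total_recursive (\<lambda>xs. arg (h xs) i)"
  shows "total_recursive (\<lambda>xs. f (h xs))"
  using partial_recursive_subst[OF _ assms(2)] assms(1) unfolding total_recursive_def by blast

lemma total_recursive_drop:
  "total_recursive f \<Longrightarrow> total_recursive (\<lambda>xs. f (drop k xs))"
  by (rule total_recursive_subst) (simp_all add: total_recursive_arg)

lemma total_recursive_arg_drop [recursive]:
  "total_recursive (\<lambda>xs. arg (drop k xs) i)"
  "total_recursive (\<lambda>xs. arg (drop j (drop k xs)) i)"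
  by (simp_all add: total_recursive_arg)

lemma total_recursive_arg_Cons [recursive]:
  assumes "total_recursive f" "\<And>i. total_recursive (\<lambda>xs. arg (h xs) i)"
  shows "total_recursive (\<lambda>xs. arg (f xs # h xs) i)"
  using assms by (cases i) simp_all

lemma total_recursive_arg_Nil [recursive]: "total_recursive (\<lambda>xs. arg [] i)"
  using zero by (simp add: total_recursive_def)

lemma total_recursive_arg_tl [recursive]: "total_recursive (\<lambda>xs. arg (tl xs) i)"
  "total_recursive (\<lambda>xs. arg (tl (tl xs)) i)"
  by (simp_all add: total_recursive_arg)

lemma total_recursive_Suc [recursive]:
  assumes "total_recursive f"
  shows "total_recursive (\<lambda>xs. Suc (f xs))"
proof -
  have "total_recursive (\<lambda>xs. arg [f xs] i)" for i by (intro recursive assms)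
  from partial_recursive_subst[OF succ this] show ?thesis by (simp add: total_recursive_def)
qed

lemma total_recursive_const [recursive]: "total_recursive (\<lambda>xs. n)"
proof (induction n)
  case 0
  then show ?case using zero by (simp add: total_recursive_def)
qed (rule total_recursive_Suc)

text \<open>In the premise on \<open>g\<close>, the two bound variables are the first two arguments, and the
  remaining ones are found after dropping these.\<close>

lemma total_recursive_rec_nat [recursive]:
  assumes f: "total_recursive f"
    and g: "total_recursive (\<lambda>ys. g (arg ys 0) (arg ys 1) (drop 2 ys))"
    and h: "total_recursive h"
  shows "total_recursive (\<lambda>xs. rec_nat (f xs) (\<lambda>k y. g k y xs) (h xs))"
proof -
  have eq: "rec_nat (Some a) (\<lambda>k r. Option.bind r (\<lambda>y. Some (G k y))) n = Some (rec_nat a G n)"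
    for a G n by (induction n) simp_all
  have "total_recursive (\<lambda>zs. rec_nat (f (tl zs)) (\<lambda>k y. g k y (tl zs)) (arg zs 0))"
    using prim[OF f[unfolded total_recursive_def] g[unfolded total_recursive_def]]
    by (simp add: total_recursive_def eq)
  from total_recursive_subst[OF this, of "\<lambda>xs. h xs # xs"] show ?thesis
    using h by (simp add: recursive)
qed

lemma total_recursive_add [recursive]:
  assumes "total_recursive f" "total_recursive g"
  shows "total_recursive (\<lambda>xs. f xs + g xs)"
proof -
  have "rec_nat a (\<lambda>_ y. Suc y) b = a + b" for a b by (induction b) simp_all
  moreover have "total_recursive (\<lambda>xs. rec_nat (f xs) (\<lambda>_ y. Suc y) (g xs))"
    by (intro recursive assms)
  ultimately show ?thesis by simp
qed

lemma total_recursive_mult [recursive]: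
  assumes "total_recursive f" "total_recursive g"
  shows "total_recursive (\<lambda>xs. f xs * g xs)"
proof -
  have "rec_nat 0 (\<lambda>_ y. a + y) b = a * b" for a b :: nat by (induction b) simp_all
  moreover have "total_recursive (\<lambda>xs. rec_nat 0 (\<lambda>_ y. f xs + y) (g xs))"
    by (intro recursive assms total_recursive_drop)
  ultimately show ?thesis by simp
qed

lemma total_recursive_power [recursive]:
  assumes "total_recursive f" "total_recursive g"
  shows "total_recursive (\<lambda>xs. f xs ^ g xs)"
proof -
  have "rec_nat 1 (\<lambda>_ y. a * y) b = a ^ b" for a b :: nat by (induction b) simp_all
  moreover have "total_recursive (\<lambda>xs. rec_nat 1 (\<lambda>_ y. f xs * y) (g xs))"
    by (intro recursive assms total_recursive_drop)
  ultimately show ?thesis by simp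
qed

lemma total_recursive_diff [recursive]:
  assumes "total_recursive f" "total_recursive g"
  shows "total_recursive (\<lambda>xs. f xs - g xs)"
proof -
  have pred: "total_recursive (\<lambda>xs. h xs - 1)" if "total_recursive h" for h
  proof -
    have "rec_nat 0 (\<lambda>k _. k) n = n - 1" for n by (induction n) simp_all
    moreover have "total_recursive (\<lambda>xs. rec_nat 0 (\<lambda>k _. k) (h xs))"
      by (intro recursive that)
    ultimately show ?thesis by simp
  qed
  have "rec_nat a (\<lambda>_ y. y - 1) b = a - b" for a b :: nat by (induction b) simp_all
  moreover have "total_recursive (\<lambda>xs. rec_nat (f xs) (\<lambda>_ y. y - 1) (g xs))"
    by (intro recursive assms pred)
  ultimately show ?thesis by simp
qed

lemma recursive_pred_le [recursive]:
  assumes "total_recursive f" "total_recursive g"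
  shows "recursive_pred (\<lambda>xs. f xs \<le> g xs)"
proof -
  have "of_bool (a \<le> b) = 1 - (a - b)" for a b :: nat by simp
  then show ?thesis unfolding recursive_pred_def by (simp only:) (intro recursive assms)
qed

lemma recursive_pred_not [recursive]:
  assumes "recursive_pred P"
  shows "recursive_pred (\<lambda>xs. \<not> P xs)"
proof -
  have "of_bool (\<not> p) = (1::nat) - of_bool p" for p by simp
  then show ?thesis unfolding recursive_pred_def
    by (simp only:) (intro recursive assms[unfolded recursive_pred_def])
qed

lemma recursive_pred_conj [recursive]:
  assumes "recursive_pred P" "recursive_pred Q"
  shows "recursive_pred (\<lambda>xs. P xs \<and> Q xs)"
  using assms unfolding recursive_pred_def of_bool_conj by (rule total_recursive_mult)

lemma recursive_pred_disj [recursive]: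
  assumes "recursive_pred P" "recursive_pred Q"
  shows "recursive_pred (\<lambda>xs. P xs \<or> Q xs)"
  using recursive_pred_not[OF recursive_pred_conj[OF assms[THEN recursive_pred_not]]] by simp

lemma recursive_pred_imp [recursive]:
  assumes "recursive_pred P" "recursive_pred Q"
  shows "recursive_pred (\<lambda>xs. P xs \<longrightarrow> Q xs)"
  unfolding imp_conv_disj by (intro recursive assms)

lemma recursive_pred_const [recursive]: "recursive_pred (\<lambda>xs. p)"
  unfolding recursive_pred_def by (rule total_recursive_const)

lemma recursive_pred_less [recursive]:
  assumes "total_recursive f" "total_recursive g"
  shows "recursive_pred (\<lambda>xs. f xs < g xs)"
  unfolding not_le[symmetric] by (intro recursive assms)

lemma recursive_pred_eq [recursive]:
  assumes "total_recursive f" "total_recursive g"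
  shows "recursive_pred (\<lambda>xs. f xs = g xs)"
  unfolding order_eq_iff by (intro recursive assms)

lemma total_recursive_if [recursive]:
  assumes "recursive_pred P" "total_recursive f" "total_recursive g"
  shows "total_recursive (\<lambda>xs. if P xs then f xs else g xs)"
proof -
  have "(if p then a else b) = of_bool p * a + (1 - of_bool p) * b" for p and a b :: nat by simp
  then show ?thesis unfolding recursive_pred_def
    by (simp only:) (intro recursive assms[unfolded recursive_pred_def])
qed

text \<open>A bounded quantifier is a product of truth values. The bound variable is argument 0;
  argument 1 is the slot of the recursion value, hence \<open>drop 2\<close>.\<close>

lemma recursive_pred_all_less [recursive]:
  assumes "recursive_pred (\<lambda>ys. P (arg ys 0) (drop 2 ys))" "total_recursive h"
  shows "recursive_pred (\<lambda>xs. \<forall>k<h xs. P k xs)"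
proof -
  have "rec_nat 1 (\<lambda>k y. of_bool (p k) * y) n = (of_bool (\<forall>k<n. p k) :: nat)" for p n
    by (induction n) (auto simp: less_Suc_eq)
  moreover have "total_recursive (\<lambda>xs. rec_nat 1 (\<lambda>k y. of_bool (P k xs) * y) (h xs))"
    by (intro recursive assms assms[unfolded recursive_pred_def])
  ultimately show ?thesis unfolding recursive_pred_def by simp
qed

lemma recursive_pred_ball_list:
  assumes "\<And>g. g \<in> set gs \<Longrightarrow> recursive_pred (P g)"
  shows "recursive_pred (\<lambda>xs. \<forall>g\<in>set gs. P g xs)"
  using assms by (induction gs) (auto intro!: recursive)

lemma recursive_pred_even [recursive]:
  assumes "total_recursive f"
  shows "recursive_pred (\<lambda>xs. even (f xs))"
proof -
  have "rec_nat 1 (\<lambda>_ y. 1 - y) n = (of_bool (even n) :: nat)" for n by (induction n) simp_all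
  moreover have "total_recursive (\<lambda>xs. rec_nat 1 (\<lambda>_ y. 1 - y) (f xs))"
    by (intro recursive assms)
  ultimately show ?thesis unfolding recursive_pred_def by simp
qed

lemma total_recursive_div2 [recursive]:
  assumes "total_recursive f"
  shows "total_recursive (\<lambda>xs. f xs div 2)"
proof -
  have "rec_nat 0 (\<lambda>k y. if even k then y else Suc y) n = n div 2" for n by (induction n) auto
  moreover have "total_recursive (\<lambda>xs. rec_nat 0 (\<lambda>k y. if even k then y else Suc y) (f xs))"
    by (intro recursive assms)
  ultimately show ?thesis by simp
qed

lemma total_recursive_prod_encode [recursive]:
  assumes "total_recursive f" "total_recursive g"
  shows "total_recursive (\<lambda>xs. prod_encode (f xs, g xs))"
  unfolding prod_encode_def triangle_def split by (intro recursive assms)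

lemma total_recursive_prod_decode [recursive]:
  assumes "total_recursive f"
  shows "total_recursive (\<lambda>xs. fst (prod_decode (f xs)))"
    and "total_recursive (\<lambda>xs. snd (prod_decode (f xs)))"
proof -
  \<comment> \<open>\<open>diag n\<close> is the index of the diagonal containing \<open>n\<close>
    in the Cantor enumeration, found by counting up to \<open>n\<close>.\<close>
  define diag where "diag n = rec_nat 0 (\<lambda>k w. if triangle (Suc w) \<le> Suc k then Suc w else w) n" for n
  have diag: "triangle (diag n) \<le> n \<and> n < triangle (Suc (diag n))" for n
    by (induction n) (auto simp: diag_def)
  have decode: "prod_decode n = (n - triangle (diag n), diag n - (n - triangle (diag n)))" for n
  proof -
    have "n - triangle (diag n) \<le> diag n" "triangle (diag n) \<le> n"
      using diag[of n] unfolding triangle_Suc by linarith+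
    then have "prod_encode (n - triangle (diag n), diag n - (n - triangle (diag n))) = n"
      by (simp add: prod_encode_def)
    then show ?thesis by (metis prod_encode_inverse)
  qed
  have rec: "total_recursive (\<lambda>xs. diag (f xs))" unfolding diag_def triangle_def
    by (intro recursive assms)
  show "total_recursive (\<lambda>xs. fst (prod_decode (f xs)))"
    "total_recursive (\<lambda>xs. snd (prod_decode (f xs)))"
    unfolding decode triangle_def fst_conv snd_conv by (intro recursive rec assms)+
qed

text \<open>Also for \<open>e = 0\<close>: the tail of the empty list is coded by \<open>snd (prod_decode 0) = 0\<close>.\<close>

lemma recursive_pred_ball_list_decode [recursive]:
  assumes "recursive_pred (\<lambda>ys. P (arg ys 0) (drop 2 ys))" "total_recursive f"
  shows "recursive_pred (\<lambda>xs. \<forall>x\<in>set (list_decode (f xs)). P x xs)"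
proof -
  \<comment> \<open>\<open>tail e k\<close> codes the list coded by \<open>e\<close> without its
    first \<open>k\<close> entries. The tail of a nonempty list has a smaller code, so
    \<open>k < e\<close> reaches every entry.\<close>
  define tail where "tail e k = rec_nat e (\<lambda>_ e. snd (prod_decode (e - 1))) k" for e k :: nat
  have tail_Suc: "tail e (Suc k) = tail (snd (prod_decode (e - 1))) k" for e k
    by (induction k) (simp_all add: tail_def)
  have tail_0: "tail 0 k = 0" for k
    by (induction k) (simp_all add: tail_def prod_decode_def prod_decode_aux.simps)
  have eq: "(\<forall>x\<in>set (list_decode e). p x) \<longleftrightarrow>
      (\<forall>k<m. tail e k \<noteq> 0 \<longrightarrow> p (fst (prod_decode (tail e k - 1))))" if "e \<le> m" for e m p
    using that
  proof (induction m arbitrary: e)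
    case (Suc m)
    show ?case
    proof (cases e)
      case 0
      then show ?thesis by (simp add: tail_0)
    next
      case e: (Suc d)
      obtain x y where xy: "prod_decode d = (x, y)" by fastforce
      then have "y \<le> m"
        using le_prod_encode_2[of y x] Suc.prems e by (metis Suc_le_mono le_trans prod_decode_inverse)
      moreover have "tail e 0 = e" by (simp add: tail_def)
      ultimately show ?thesis
        using Suc.IH[of y] by (simp add: e xy All_less_Suc2 tail_Suc)
    qed
  qed simp
  have tail: "total_recursive (\<lambda>xs. tail (g xs) (h xs))"
    if "total_recursive g" "total_recursive h" for g h
    unfolding tail_def by (intro recursive that)
  have "recursive_pred (\<lambda>ys. P (fst (prod_decode (tail (f (drop 2 ys)) (arg ys 0) - 1))) (drop 2 ys))"
  proof -
    \<comment> \<open>The \<open>0\<close> fills the slot that \<open>drop 2\<close> skips in the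
      premise.\<close>
    let ?h = "\<lambda>ys. fst (prod_decode (tail (f (drop 2 ys)) (arg ys 0) - 1)) # 0 # drop 2 ys"
    have "total_recursive (\<lambda>ys. arg (?h ys) i)" for i
      by (intro recursive tail total_recursive_drop assms)
    from total_recursive_subst[OF assms(1)[unfolded recursive_pred_def] this]
    show ?thesis by (simp add: recursive_pred_def)
  qed
  then show ?thesis
    unfolding eq[OF order_refl] by (intro recursive assms tail total_recursive_drop)
qed

section \<open>Approximation of partial recursive functions in stages\<close>

text \<open>The approximations of \<open>f\<close> take a number of steps \<open>t\<close> as their first argument; \<open>0\<close> means that
  no value has been found yet.\<close>

definition step_approximation :: "(nat list \<Rightarrow> nat) \<Rightarrow> (nat list \<Rightarrow> nat option) \<Rightarrow> bool" where
  "step_approximation G f \<longleftrightarrow>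
     (\<forall>t xs y. G (t # xs) = Suc y \<longrightarrow> f xs = Some y) \<and>
     (\<forall>xs y. f xs = Some y \<longrightarrow> (\<forall>\<^sub>F t in sequentially. G (t # xs) = Suc y))"

lemma step_approximationD:
  assumes "step_approximation G f"
  shows "G (t # xs) = Suc y \<Longrightarrow> f xs = Some y"
    and "f xs = Some y \<Longrightarrow> \<forall>\<^sub>F t in sequentially. G (t # xs) = Suc y"
  using assms unfolding step_approximation_def by blast+

lemma step_approximation_total:
  "step_approximation (\<lambda>zs. Suc (g (tl zs))) (\<lambda>xs. Some (g xs))"
  by (simp add: step_approximation_def)

text \<open>Since values persist from some stage on, the finitely many inner functions all have
  their final values at a common stage.\<close>

lemma step_approximation_comp:
  assumes F: "step_approximation F f" and E: "\<And>g. g \<in> set gs \<Longrightarrow> step_approximation (E g) g"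
  shows "step_approximation
    (\<lambda>zs. if \<forall>g\<in>set gs. E g zs \<noteq> 0 then F (arg zs 0 # map (\<lambda>g. E g zs - 1) gs) else 0)
    (\<lambda>xs. Option.bind (those (map (\<lambda>g. g xs) gs)) f)"
proof -
  have those_Some: "those (map (\<lambda>g. g xs) gs) = Some ys \<longleftrightarrow>
      (\<forall>g\<in>set gs. g xs \<noteq> None) \<and> ys = map (\<lambda>g. the (g xs)) gs"
    for xs :: "nat list" and ys :: "nat list" and gs :: "(nat list \<Rightarrow> nat option) list"
    by (induction gs arbitrary: ys) (auto split: option.splits)
  show ?thesis
    unfolding step_approximation_def
  proof (intro conjI allI impI)
    fix t xs y
    assume "(if \<forall>g\<in>set gs. E g (t # xs) \<noteq> 0
      then F (arg (t # xs) 0 # map (\<lambda>g. E g (t # xs) - 1) gs) else 0) = Suc y"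
    then have nz: "\<forall>g\<in>set gs. E g (t # xs) \<noteq> 0" and F_eq: "F (t # map (\<lambda>g. E g (t # xs) - 1) gs) = Suc y"
      by (auto split: if_splits)
    have g_xs: "g xs = Some (E g (t # xs) - 1)" if "g \<in> set gs" for g
      using nz that by (intro step_approximationD(1)[OF E[OF that], of t]) auto
    then have "those (map (\<lambda>g. g xs) gs) = Some (map (\<lambda>g. E g (t # xs) - 1) gs)"
      unfolding those_Some by (metis (mono_tags, lifting) map_cong option.distinct(1) option.sel)
    then show "Option.bind (those (map (\<lambda>g. g xs) gs)) f = Some y"
      using step_approximationD(1)[OF F F_eq] by simp
  next
    fix xs y
    assume "Option.bind (those (map (\<lambda>g. g xs) gs)) f = Some y"
    then have def: "\<forall>g\<in>set gs. g xs \<noteq> None" and f: "f (map (\<lambda>g. the (g xs)) gs) = Some y"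
      by (auto simp: bind_eq_Some_conv those_Some)
    have "\<forall>\<^sub>F t in sequentially. \<forall>g\<in>set gs. E g (t # xs) = Suc (the (g xs))"
      using def by (intro eventually_ball_finite ballI step_approximationD(2)[OF E]) auto
    with step_approximationD(2)[OF F f]
    show "\<forall>\<^sub>F t in sequentially. (if \<forall>g\<in>set gs. E g (t # xs) \<noteq> 0
      then F (arg (t # xs) 0 # map (\<lambda>g. E g (t # xs) - 1) gs) else 0) = Suc y"
    proof eventually_elim
      case (elim t)
      then have "map (\<lambda>g. E g (t # xs) - 1) gs = map (\<lambda>g. the (g xs)) gs" by simp
      with elim show ?case by (simp only: arg_simps) simp
    qed
  qed
qed

lemma step_approximation_prim:
  assumes F: "step_approximation F f" and G: "step_approximation G g"
  shows "step_approximation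
    (\<lambda>zs. rec_nat (F (arg zs 0 # tl (tl zs)))
      (\<lambda>k r. if r = 0 then 0 else G (arg zs 0 # k # (r - 1) # tl (tl zs))) (arg zs 1))
    (\<lambda>xs. rec_nat (f (tl xs)) (\<lambda>k r. Option.bind r (\<lambda>y. g (k # y # tl xs))) (arg xs 0))"
proof -
  let ?H = "\<lambda>t ys. rec_nat (F (t # ys)) (\<lambda>k r. if r = 0 then 0 else G (t # k # (r - 1) # ys))"
  let ?R = "\<lambda>ys. rec_nat (f ys) (\<lambda>k r. Option.bind r (\<lambda>y. g (k # y # ys)))"
  have "?H t ys m = Suc y \<Longrightarrow> ?R ys m = Some y" for t ys m y
  proof (induction m arbitrary: y)
    case 0
    then show ?case using step_approximationD(1)[OF F] by simp
  next
    case (Suc m)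
    then obtain r where "?H t ys m = Suc r" by (cases "?H t ys m") auto
    with Suc show ?case using step_approximationD(1)[OF G] by simp
  qed
  moreover have "?R ys m = Some y \<Longrightarrow> \<forall>\<^sub>F t in sequentially. ?H t ys m = Suc y" for ys m y
  proof (induction m arbitrary: y)
    case 0
    then show ?case using step_approximationD(2)[OF F] by simp
  next
    case (Suc m)
    then obtain r where "?R ys m = Some r" "g (m # r # ys) = Some y"
      by (auto simp: bind_eq_Some_conv)
    from Suc.IH[OF this(1)] step_approximationD(2)[OF G this(2)] show ?case
      by eventually_elim simp
  qed
  ultimately show ?thesis
    unfolding step_approximation_def One_nat_def arg_simps list.sel by blast
qed

text \<open>The search keeps \<open>0\<close> while running, \<open>1\<close> once it is stuck at an undefined value, and \<open>j + 2\<close>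
  once it has found \<open>j\<close>.\<close>

lemma step_approximation_minimize:
  assumes F: "step_approximation F f"
  shows "step_approximation
    (\<lambda>zs. rec_nat 0 (\<lambda>k r. if r \<noteq> 0 then r else if F (arg zs 0 # k # tl zs) = 0 then 1
        else if F (arg zs 0 # k # tl zs) = 1 then k + 2 else 0) (arg zs 0) - 1)
    (\<lambda>xs. minimize (\<lambda>k. f (k # xs)))"
proof -
  let ?S = "\<lambda>t xs. rec_nat (0::nat) (\<lambda>k r. if r \<noteq> 0 then r else if F (t # k # xs) = 0 then 1
        else if F (t # k # xs) = 1 then k + 2 else 0)"
  have inv: "(?S t xs m = 0 \<longrightarrow> (\<forall>i<m. \<exists>y. f (i # xs) = Some (Suc y))) \<and>
      (\<forall>j. ?S t xs m = j + 2 \<longrightarrow> f (j # xs) = Some 0 \<and> (\<forall>i<j. \<exists>y. f (i # xs) = Some (Suc y)))"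
    for t xs m
  proof (induction m)
    case (Suc m)
    consider "?S t xs m \<noteq> 0" | "?S t xs m = 0" "F (t # m # xs) = 0"
      | "?S t xs m = 0" "F (t # m # xs) = 1" | y where "?S t xs m = 0" "F (t # m # xs) = Suc (Suc y)"
      by (metis One_nat_def old.nat.exhaust)
    then show ?case
    proof cases
      case 3
      then show ?thesis using Suc step_approximationD(1)[OF F, of t "m # xs" 0] by simp
    next
      case (4 y)
      then show ?thesis using Suc step_approximationD(1)[OF F, of t "m # xs" "Suc y"]
        by (simp add: less_Suc_eq)
    qed (use Suc in simp_all)
  qed simp
  have Least: "minimize p = Some j \<longleftrightarrow> p j = Some 0 \<and> (\<forall>i<j. \<exists>y. p i = Some (Suc y))" for p j
  proof
    assume "minimize p = Some j"
    then obtain k where k: "p k = Some 0" "\<forall>i<k. p i \<noteq> None" and j: "j = (LEAST k. p k = Some 0)"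
      by (auto simp: minimize_def split: if_splits)
    have "p j = Some 0" unfolding j by (rule LeastI[of "\<lambda>k. p k = Some 0", OF k(1)])
    moreover have "\<exists>y. p i = Some (Suc y)" if "i < j" for i
    proof -
      have "j \<le> k" unfolding j by (rule Least_le[of "\<lambda>k. p k = Some 0", OF k(1)])
      then have "p i \<noteq> None" using k(2) that by auto
      moreover have "p i \<noteq> Some 0" using not_less_Least that unfolding j by blast
      ultimately show ?thesis by (metis not0_implies_Suc option.exhaust)
    qed
    ultimately show "p j = Some 0 \<and> (\<forall>i<j. \<exists>y. p i = Some (Suc y))" by blast
  next
    assume *: "p j = Some 0 \<and> (\<forall>i<j. \<exists>y. p i = Some (Suc y))"
    then have "(LEAST k. p k = Some 0) = j"
      by (intro Least_equality) (auto simp: not_less[symmetric])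
    moreover have "\<exists>k. p k = Some 0 \<and> (\<forall>i<k. p i \<noteq> None)" using * by fastforce
    ultimately show "minimize p = Some j" by (simp add: minimize_def)
  qed
  show ?thesis
    unfolding step_approximation_def arg_simps list.sel
  proof (intro conjI allI impI)
    fix t xs y assume "?S t xs t - 1 = Suc y"
    \<comment> \<open>Subtracting 1 merges the running state 0 and the stuck state 1 into "no value"
      and leaves \<open>Suc j\<close> for a result \<open>j\<close>.\<close>
    then have "?S t xs t = y + 2" by linarith
    then show "minimize (\<lambda>k. f (k # xs)) = Some y" using inv[of t xs t] by (simp add: Least)
  next
    fix xs j assume "minimize (\<lambda>k. f (k # xs)) = Some j"
    then have j: "f (j # xs) = Some 0" and less: "\<forall>i<j. f (i # xs) \<noteq> None \<and> f (i # xs) \<noteq> Some 0"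
      by (auto simp: Least)
    have "\<forall>\<^sub>F t in sequentially. \<forall>i\<in>{..<j}. F (t # i # xs) = Suc (the (f (i # xs)))"
      using less by (intro eventually_ball_finite ballI step_approximationD(2)[OF F]) auto
    moreover have "\<forall>\<^sub>F t in sequentially. F (t # j # xs) = Suc 0"
      by (rule step_approximationD(2)[OF F j])
    moreover have "\<forall>\<^sub>F t in sequentially. t > j" by (rule eventually_gt_at_top)
    ultimately show "\<forall>\<^sub>F t in sequentially. ?S t xs t - 1 = Suc j"
    proof eventually_elim
      case (elim t)
      have "?S t xs m = 0" if "m \<le> j" for m
        using that
      proof (induction m)
        case (Suc m)
        then have "F (t # m # xs) = Suc (the (f (m # xs)))" "the (f (m # xs)) \<noteq> 0"
          using elim(1) less by (auto simp: Suc_le_eq)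
        with Suc show ?case by simp
      qed simp
      then have "?S t xs (Suc j + m) = j + 2" for m
        using elim(2) by (induction m) simp_all
      from this[of "t - Suc j"] show ?case using elim(3) by simp
    qed
  qed
qed

text \<open>This takes the place of Kleene's normal form: each function gets its own stage
  approximation by induction on its construction, without a universal machine.\<close>

lemma ex_step_approximation:
  assumes "partial_recursive f"
  shows "\<exists>G. total_recursive G \<and> step_approximation G f"
  using assms
proof induction
  case zero
  show ?case
    by (rule exI, rule conjI[OF _ step_approximation_total[of "\<lambda>_. 0"]]) (intro recursive)
next
  case succ
  show ?case
    by (rule exI, rule conjI[OF _ step_approximation_total], unfold arg_simps) (intro recursive)
next
  case (proj i)
  show ?case
    by (rule exI, rule conjI[OF _ step_approximation_total], unfold arg_simps) (intro recursive)
next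
  case (comp f gs)
  then obtain F E where F: "total_recursive F" "step_approximation F f"
    and E: "\<And>g. g \<in> set gs \<Longrightarrow> total_recursive (E g) \<and> step_approximation (E g) g"
    by metis
  have "total_recursive (\<lambda>zs. arg (map (\<lambda>g. E g zs - 1) gs) i)" for i
    using E
  proof (induction gs arbitrary: i)
    case (Cons g gs)
    then show ?case by (auto intro!: recursive)
  qed (simp add: total_recursive_const)
  then have "total_recursive (\<lambda>zs. arg (arg zs 0 # map (\<lambda>g. E g zs - 1) gs) i)" for i
    by (intro recursive)
  then have "total_recursive (\<lambda>zs. F (arg zs 0 # map (\<lambda>g. E g zs - 1) gs))"
    by (rule total_recursive_subst[OF F(1)])
  then have "total_recursive
    (\<lambda>zs. if \<forall>g\<in>set gs. E g zs \<noteq> 0 then F (arg zs 0 # map (\<lambda>g. E g zs - 1) gs) else 0)"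
    by (intro recursive recursive_pred_ball_list) (use E in blast)
  with step_approximation_comp[OF F(2), of gs E] E show ?case by blast
next
  case (prim f g)
  then obtain F G where F: "total_recursive F" "step_approximation F f"
    and G: "total_recursive G" "step_approximation G g"
    by blast
  have "total_recursive (\<lambda>zs. rec_nat (F (arg zs 0 # tl (tl zs)))
      (\<lambda>k r. if r = 0 then 0 else G (arg zs 0 # k # (r - 1) # tl (tl zs))) (arg zs 1))"
    by (intro recursive total_recursive_subst[OF F(1)] total_recursive_subst[OF G(1)];
      (unfold arg_simps)?; intro recursive)
  with step_approximation_prim[OF F(2) G(2)] show ?case by blast
next
  case (mini f)
  then obtain F where F: "total_recursive F" "step_approximation F f" by blast
  have "total_recursive (\<lambda>zs. rec_nat 0 (\<lambda>k r. if r \<noteq> 0 then r else if F (arg zs 0 # k # tl zs) = 0 then 1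
        else if F (arg zs 0 # k # tl zs) = 1 then k + 2 else 0) (arg zs 0) - 1)"
    by (intro recursive total_recursive_subst[OF F(1)]; (unfold arg_simps)?; intro recursive)
  with step_approximation_minimize[OF F(2)] show ?case by blast
qed

section \<open>C.e. sets as projections of decidable relations\<close>

lemma minimize_of_bool:
  "minimize (\<lambda>s. Some (of_bool (\<not> P s))) = (if \<exists>s. P s then Some (LEAST s. P s) else None)"
  by (simp add: minimize_def)

lemma ce_if_recursive_pred:
  assumes "recursive_pred (\<lambda>xs. P (arg xs 1) (arg xs 0))"
  shows "ce {e. \<exists>s. P e s}"
proof -
  let ?f = "\<lambda>xs. minimize (\<lambda>s. Some (of_bool (\<not> P (arg (s # xs) 1) (arg (s # xs) 0))))"
  have "partial_recursive ?f"
    using recursive_pred_not[OF assms] unfolding recursive_pred_def total_recursive_def by (rule mini)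
  moreover have "{e. \<exists>s. P e s} = {e. ?f [e] \<noteq> None}"
    by (auto simp: minimize_of_bool)
  ultimately show ?thesis unfolding ce_def by blast
qed

text \<open>The witness \<open>s\<close> is a stage at which a value has appeared. Decidability of
  \<open>P\<close> is stated with recursive functions substituted, the form in which it combines
  with the rules \<open>recursive\<close>.\<close>

lemma recursive_pred_if_ce:
  assumes "ce S"
  obtains P where "\<And>f g. total_recursive f \<Longrightarrow> total_recursive g \<Longrightarrow> recursive_pred (\<lambda>xs. P (f xs) (g xs))"
    and "\<And>e. e \<in> S \<longleftrightarrow> (\<exists>s. P e s)"
proof -
  obtain h where h: "partial_recursive h" "S = {e. h [e] \<noteq> None}"
    using assms unfolding ce_def by blast
  obtain G where G: "total_recursive G" "step_approximation G h"
    using ex_step_approximation[OF h(1)] by blast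
  have "h [e] \<noteq> None \<longleftrightarrow> (\<exists>s. G [s, e] \<noteq> 0)" for e
  proof
    assume "h [e] \<noteq> None"
    then obtain y where "h [e] = Some y" by blast
    from eventually_happens'[OF sequentially_bot step_approximationD(2)[OF G(2) this]]
    show "\<exists>s. G [s, e] \<noteq> 0" by (metis nat.distinct(1))
  next
    assume "\<exists>s. G [s, e] \<noteq> 0"
    then show "h [e] \<noteq> None"
      using step_approximationD(1)[OF G(2)] by (metis not0_implies_Suc option.distinct(1))
  qed
  moreover have "recursive_pred (\<lambda>xs. G [g xs, f xs] \<noteq> 0)"
    if "total_recursive f" "total_recursive g" for f g
    by (intro recursive total_recursive_subst[OF G(1)] that)
  ultimately show thesis using that[of "\<lambda>e s. G [s, e] \<noteq> 0"] h(2) by blast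
qed

lemma ex_partial_recursive_search:
  assumes "recursive_pred (\<lambda>xs. Q (arg xs 1) (arg xs 2) (arg xs 0))"
    and "total_recursive g"
  obtains f where "partial_recursive f"
    and "\<And>e k. \<exists>s. Q e k s \<Longrightarrow> \<exists>s. Q e k s \<and> f [e, k] = Some (g [s])"
proof -
  let ?m = "\<lambda>xs. minimize (\<lambda>s. Some (of_bool (\<not> Q (arg (s # xs) 1) (arg (s # xs) 2) (arg (s # xs) 0))))"
  let ?f = "\<lambda>xs. Option.bind (those (map (\<lambda>h. h xs) [?m])) (\<lambda>xs. Some (g xs))"
  have "partial_recursive ?m"
    using recursive_pred_not[OF assms(1)] unfolding recursive_pred_def total_recursive_def by (rule mini)
  then have f: "partial_recursive ?f"
    using assms(2) unfolding total_recursive_def by (intro comp) simp_all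
  have Q: "\<exists>s. Q e k s \<and> ?f [e, k] = Some (g [s])" if ex: "\<exists>s. Q e k s" for e k
  proof (intro exI conjI)
    show "Q e k (LEAST s. Q e k s)" using ex by (rule LeastI_ex)
    have "arg (s # [e, k]) 2 = k" for s by (simp add: numeral_2_eq_2)
    then show "?f [e, k] = Some (g [LEAST s. Q e k s])"
      using ex by (simp add: minimize_of_bool)
  qed
  show thesis by (rule that[OF f Q])
qed

section \<open>Computing norms from enumerated bounds\<close>

text \<open>Together with \<open>pos_denominator\<close> this gives a fraction of natural numbers
  for the nonnegative part of a coded rational. \<open>int_decode\<close> is nonnegative exactly at
  even codes, so equal parities mean a nonnegative quotient; a zero denominator codes the rational
  0.\<close>

definition pos_numerator :: "nat \<Rightarrow> nat" where
  "pos_numerator v =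
     (if (even (fst (prod_decode v)) \<longleftrightarrow> even (snd (prod_decode v))) \<and> snd (prod_decode v) \<noteq> 0
      then Suc (fst (prod_decode v)) div 2 else 0)"

definition pos_denominator :: "nat \<Rightarrow> nat" where
  "pos_denominator v = (if snd (prod_decode v) = 0 then 1 else Suc (snd (prod_decode v)) div 2)"

lemma pos_denominator_pos: "pos_denominator v > 0"
  by (auto simp: pos_denominator_def)

lemma max_0_nat_to_rat_surj:
  "max 0 (real_of_rat (nat_to_rat_surj v)) = real (pos_numerator v) / real (pos_denominator v)"
proof -
  obtain i j where ij: "prod_decode v = (i, j)" by fastforce
  have int_decode: "real_of_int (int_decode l) = (if even l then 1 else - 1) * real (Suc l div 2)" for l
    by (auto simp: int_decode_def sum_decode_def elim!: evenE oddE)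
  show ?thesis
  proof (cases "j = 0")
    case True
    then show ?thesis
      by (simp add: nat_to_rat_surj_def ij pos_numerator_def int_decode_def sum_decode_def rat_number_collapse)
  next
    case False
    then have "int_decode j \<noteq> 0"
      using int_decode[of j] by (auto simp: of_int_0_eq_iff[where 'a = real, symmetric] simp del: of_int_0_eq_iff split: if_splits)
    with False show ?thesis
      by (auto simp: nat_to_rat_surj_def ij pos_numerator_def pos_denominator_def of_rat_rat int_decode
          max_def divide_simps mult_le_0_iff zero_le_mult_iff)
  qed
qed

lemma total_recursive_pos_numerator [recursive]:
  "total_recursive f \<Longrightarrow> total_recursive (\<lambda>xs. pos_numerator (f xs))"
  unfolding pos_numerator_def iff_conv_conj_imp by (intro recursive)

lemma total_recursive_pos_denominator [recursive]:
  "total_recursive f \<Longrightarrow> total_recursive (\<lambda>xs. pos_denominator (f xs))"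
  unfolding pos_denominator_def by (intro recursive)

lemma recursive_pred_enat_less [recursive]:
  "total_recursive f \<Longrightarrow> recursive_pred (\<lambda>xs. enat (f xs) < n)"
  by (cases n) (auto intro: recursive)

lemma nat_to_rat_surj_eq_0_iff:
  "nat_to_rat_surj v = 0 \<longleftrightarrow> fst (prod_decode v) = 0 \<or> snd (prod_decode v) = 0"
proof -
  have "int_decode l = 0 \<longleftrightarrow> l = 0" for l
    by (auto simp: int_decode_def sum_decode_def odd_pos elim: evenE)
  moreover have "Fract i j = 0 \<longleftrightarrow> i = 0 \<or> j = 0" for i j
    by (cases "j = 0") (simp_all add: Zero_rat_def eq_rat)
  ultimately show ?thesis by (simp add: nat_to_rat_surj_def split: prod.split)
qed

text \<open>All conditions become bounded checks on codes. A real coefficient shows in a zero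
  numerator or denominator of the imaginary part; the parity of a letter code distinguishes a
  special point from its adjoint, and half of it is the index.\<close>

lemma decode_polynomial_rational_iff:
  assumes "K = \<real> \<or> K = UNIV"
  shows "decode_polynomial e \<in> rational_polynomials K n \<longleftrightarrow>
    (\<forall>m\<in>set (list_decode e).
      (K = UNIV \<or> fst (prod_decode (snd (prod_decode (fst (prod_decode m))))) = 0
               \<or> snd (prod_decode (snd (prod_decode (fst (prod_decode m))))) = 0) \<and>
      snd (prod_decode m) \<noteq> 0 \<and>
      (\<forall>l\<in>set (list_decode (snd (prod_decode m))). enat (l div 2) < n))"
proof -
  have "list_decode w = [] \<longleftrightarrow> w = 0" for w
    by (metis list_decode.simps(1) list_decode_inverse)
  moreover have "case_sum id id (sum_decode l) = l div 2" for l
    by (simp add: sum_decode_def)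
  moreover have "Complex x y \<in> K \<longleftrightarrow> K = UNIV \<or> y = 0" for x y
    using assms by (auto simp: complex_is_Real_iff)
  ultimately show ?thesis
    by (auto simp: rational_polynomials_def decode_polynomial_def decode_term_def
        nat_to_rat_surj_eq_0_iff split_beta Let_def)
qed

lemma recursive_pred_rational [recursive]:
  assumes "K = \<real> \<or> K = UNIV" and "total_recursive f"
  shows "recursive_pred (\<lambda>xs. decode_polynomial (f xs) \<in> rational_polynomials K n)"
  unfolding decode_polynomial_rational_iff[OF assms(1)] by (intro recursive assms(2))

definition radius :: "nat \<Rightarrow> real" where
  "radius r = real (Suc (fst (prod_decode r))) / 2 ^ snd (prod_decode r)"

text \<open>Denominators are cleared and the error term is added to the smaller side, so that the
  comparison avoids the truncated subtraction of natural numbers.\<close>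

lemma less_radius_iff:
  "real (pos_numerator v) / real (pos_denominator v) + 1 / 2 ^ k < radius r \<longleftrightarrow>
     pos_numerator v * 2 ^ k * 2 ^ snd (prod_decode r) + pos_denominator v * 2 ^ snd (prod_decode r)
       < Suc (fst (prod_decode r)) * pos_denominator v * 2 ^ k"
  and radius_less_iff:
  "radius r < real (pos_numerator v) / real (pos_denominator v) - 1 / 2 ^ k \<longleftrightarrow>
     Suc (fst (prod_decode r)) * pos_denominator v * 2 ^ k + pos_denominator v * 2 ^ snd (prod_decode r)
       < pos_numerator v * 2 ^ k * 2 ^ snd (prod_decode r)"
proof -
  have D: "real (pos_denominator v) > 0" using pos_denominator_pos[of v] by simp
  have less: "x / d + 1 / y < m / z \<longleftrightarrow> x * y * z + d * z < m * d * y"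
    and greater: "m / z < x / d - 1 / y \<longleftrightarrow> m * d * y + d * z < x * y * z"
    if "d > 0" "y > 0" "z > 0" for x d m y z :: real
    using that by (simp_all add: field_simps)
  show "real (pos_numerator v) / real (pos_denominator v) + 1 / 2 ^ k < radius r \<longleftrightarrow>
     pos_numerator v * 2 ^ k * 2 ^ snd (prod_decode r) + pos_denominator v * 2 ^ snd (prod_decode r)
       < Suc (fst (prod_decode r)) * pos_denominator v * 2 ^ k"
    unfolding radius_def less[OF D zero_less_power[OF zero_less_numeral] zero_less_power[OF zero_less_numeral]]
    by (subst of_nat_less_iff[where 'a = real, symmetric]) (simp only: of_nat_simps of_nat_power of_nat_numeral)
  show "radius r < real (pos_numerator v) / real (pos_denominator v) - 1 / 2 ^ k \<longleftrightarrow>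
     Suc (fst (prod_decode r)) * pos_denominator v * 2 ^ k + pos_denominator v * 2 ^ snd (prod_decode r)
       < pos_numerator v * 2 ^ k * 2 ^ snd (prod_decode r)"
    unfolding radius_def greater[OF D zero_less_power[OF zero_less_numeral] zero_less_power[OF zero_less_numeral]]
    by (subst of_nat_less_iff[where 'a = real, symmetric]) (simp only: of_nat_simps of_nat_power of_nat_numeral)
qed

lemma ce_radius_if_approximable:
  fixes N :: "nat \<Rightarrow> real"
  assumes R: "\<And>f. total_recursive f \<Longrightarrow> recursive_pred (\<lambda>xs. R (f xs))"
    and nonneg: "\<And>e. 0 \<le> N e"
    and f: "partial_recursive f"
    and approx: "\<And>e k. R e \<Longrightarrow>
      \<exists>v. f [e, k] = Some v \<and> \<bar>N e - of_rat (nat_to_rat_surj v)\<bar> < 1 / 2 ^ k"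
  shows "ce {b. R (fst (prod_decode b)) \<and> N (fst (prod_decode b)) < radius (snd (prod_decode b))}"
    and "ce {b. R (fst (prod_decode b)) \<and> radius (snd (prod_decode b)) < N (fst (prod_decode b))}"
proof -
  obtain G where G: "total_recursive G" "step_approximation G f"
    using ex_step_approximation[OF f] by blast
  define q where "q v = real (pos_numerator v) / real (pos_denominator v)" for v
  have sound: "\<bar>N e - q (G [t, e, k] - 1)\<bar> < 1 / 2 ^ k" if "R e" "G [t, e, k] \<noteq> 0" for e k t
  proof -
    have "f [e, k] = Some (G [t, e, k] - 1)"
      using that by (intro step_approximationD(1)[OF G(2), of t]) simp
    then have "\<bar>N e - of_rat (nat_to_rat_surj (G [t, e, k] - 1))\<bar> < 1 / 2 ^ k"
      using approx[OF that(1), of k] by simp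
    \<comment> \<open>Truncating the approximation at 0 does not increase its error, as
      \<open>N e\<close> is nonnegative.\<close>
    then show ?thesis
      using nonneg[of e] by (simp add: q_def flip: max_0_nat_to_rat_surj)
  qed
  have complete: "\<exists>t. G [t, e, k] \<noteq> 0" if R: "R e" for e k
  proof -
    obtain v where v: "f [e, k] = Some v" using approx[OF R, of k] by blast
    from eventually_happens'[OF sequentially_bot step_approximationD(2)[OF G(2) v]]
    show ?thesis by (metis nat.distinct(1))
  qed
  \<comment> \<open>One \<open>1 / 2 ^ k\<close> is the error of the approximation, the other the
    safety margin in the test.\<close>
  have small: "\<exists>k. 2 / 2 ^ k < d" if "d > 0" for d :: real
  proof -
    have "0 < d / 2" "1 / 2 < (1::real)" using that by simp_all
    then obtain k where "(1/2) ^ k < d / 2" using real_arch_pow_inv by blast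
    then show ?thesis by (intro exI[of _ k]) (simp add: power_divide)
  qed
  \<comment> \<open>The witness \<open>s\<close> codes a stage and a precision.\<close>
  have less: "N e < r \<longleftrightarrow> (\<exists>s. G [fst (prod_decode s), e, snd (prod_decode s)] \<noteq> 0 \<and>
      q (G [fst (prod_decode s), e, snd (prod_decode s)] - 1) + 1 / 2 ^ snd (prod_decode s) < r)"
    if R: "R e" for e r
  proof
    assume "N e < r"
    then obtain k where k: "2 / 2 ^ k < r - N e" using small[of "r - N e"] by auto
    obtain t where t: "G [t, e, k] \<noteq> 0" using complete[OF R] by blast
    have "q (G [t, e, k] - 1) + 1 / 2 ^ k < r"
      using sound[OF R t] k by (simp add: abs_less_iff)
    with t show "\<exists>s. G [fst (prod_decode s), e, snd (prod_decode s)] \<noteq> 0 \<and>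
      q (G [fst (prod_decode s), e, snd (prod_decode s)] - 1) + 1 / 2 ^ snd (prod_decode s) < r"
      by (intro exI[of _ "prod_encode (t, k)"]) simp
  qed (use sound[OF R] in \<open>fastforce simp: abs_less_iff\<close>)
  have greater: "r < N e \<longleftrightarrow> (\<exists>s. G [fst (prod_decode s), e, snd (prod_decode s)] \<noteq> 0 \<and>
      r < q (G [fst (prod_decode s), e, snd (prod_decode s)] - 1) - 1 / 2 ^ snd (prod_decode s))"
    if R: "R e" for e r
  proof
    assume "r < N e"
    then obtain k where k: "2 / 2 ^ k < N e - r" using small[of "N e - r"] by auto
    obtain t where t: "G [t, e, k] \<noteq> 0" using complete[OF R] by blast
    have "r < q (G [t, e, k] - 1) - 1 / 2 ^ k"
      using sound[OF R t] k by (simp add: abs_less_iff)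
    with t show "\<exists>s. G [fst (prod_decode s), e, snd (prod_decode s)] \<noteq> 0 \<and>
      r < q (G [fst (prod_decode s), e, snd (prod_decode s)] - 1) - 1 / 2 ^ snd (prod_decode s)"
      by (intro exI[of _ "prod_encode (t, k)"]) simp
  qed (use sound[OF R] in \<open>fastforce simp: abs_less_iff\<close>)
  have "{b. R (fst (prod_decode b)) \<and> N (fst (prod_decode b)) < radius (snd (prod_decode b))}
    = {b. \<exists>s. R (fst (prod_decode b)) \<and>
        G [fst (prod_decode s), fst (prod_decode b), snd (prod_decode s)] \<noteq> 0 \<and>
        q (G [fst (prod_decode s), fst (prod_decode b), snd (prod_decode s)] - 1)
          + 1 / 2 ^ snd (prod_decode s) < radius (snd (prod_decode b))}"
    using less by auto
  moreover have "ce \<dots>"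
    unfolding q_def less_radius_iff
    by (rule ce_if_recursive_pred) (intro recursive R total_recursive_subst[OF G(1)])
  ultimately show "ce {b. R (fst (prod_decode b)) \<and> N (fst (prod_decode b)) < radius (snd (prod_decode b))}"
    by simp
  have "{b. R (fst (prod_decode b)) \<and> radius (snd (prod_decode b)) < N (fst (prod_decode b))}
    = {b. \<exists>s. R (fst (prod_decode b)) \<and>
        G [fst (prod_decode s), fst (prod_decode b), snd (prod_decode s)] \<noteq> 0 \<and>
        radius (snd (prod_decode b)) < q (G [fst (prod_decode s), fst (prod_decode b), snd (prod_decode s)] - 1)
          - 1 / 2 ^ snd (prod_decode s)}"
    using greater by auto
  moreover have "ce \<dots>"
    unfolding q_def radius_less_iff
    by (rule ce_if_recursive_pred) (intro recursive R total_recursive_subst[OF G(1)])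
  ultimately show "ce {b. R (fst (prod_decode b)) \<and> radius (snd (prod_decode b)) < N (fst (prod_decode b))}"
    by simp
qed

text \<open>With unit \<open>2\<^sup>-\<^sup>k\<^sup>-\<^sup>1\<close>, the search is for some \<open>m\<close> with \<open>m < N e < m + 2\<close>, the
  lower bound being void for \<open>m = 0\<close>; then \<open>m + 1\<close> is the approximation.\<close>

lemma approximable_if_ce_radius:
  fixes N :: "nat \<Rightarrow> real"
  assumes nonneg: "\<And>e. 0 \<le> N e"
    and less: "ce {b. R (fst (prod_decode b)) \<and> N (fst (prod_decode b)) < radius (snd (prod_decode b))}"
    and greater: "ce {b. R (fst (prod_decode b)) \<and> radius (snd (prod_decode b)) < N (fst (prod_decode b))}"
  obtains f where "partial_recursive f"
    and "\<And>e k. R e \<Longrightarrow> \<exists>v. f [e, k] = Some v \<and> \<bar>N e - of_rat (nat_to_rat_surj v)\<bar> < 1 / 2 ^ k"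
proof -
  obtain P where P: "\<And>f g. total_recursive f \<Longrightarrow> total_recursive g \<Longrightarrow> recursive_pred (\<lambda>xs. P (f xs) (g xs))"
    and P_iff: "\<And>b. R (fst (prod_decode b)) \<and> N (fst (prod_decode b)) < radius (snd (prod_decode b)) \<longleftrightarrow>
      (\<exists>s. P b s)"
    using recursive_pred_if_ce[OF less] by auto
  obtain P' where P': "\<And>f g. total_recursive f \<Longrightarrow> total_recursive g \<Longrightarrow> recursive_pred (\<lambda>xs. P' (f xs) (g xs))"
    and P'_iff: "\<And>b. R (fst (prod_decode b)) \<and> radius (snd (prod_decode b)) < N (fst (prod_decode b)) \<longleftrightarrow>
      (\<exists>s. P' b s)"
    using recursive_pred_if_ce[OF greater] by auto
  \<comment> \<open>Nonnegative integers have even codes, hence the factors 2: this codes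
    \<open>(m + 1) / 2 ^ (k + 1)\<close>.\<close>
  define v where "v k m = prod_encode (2 * Suc m, 2 * 2 ^ Suc k)" for k m :: nat
  have v: "real_of_rat (nat_to_rat_surj (v k m)) = real (Suc m) / 2 ^ Suc k" for k m
    by (simp add: v_def nat_to_rat_surj_def int_decode_def sum_decode_def of_rat_rat)
  \<comment> \<open>The searched number \<open>s\<close> codes the output, \<open>m\<close>, and the
    stages confirming the upper and the lower bound. Keeping the output in \<open>s\<close> makes it
    a function of \<open>s\<close> alone.\<close>
  define Q where "Q e k s \<longleftrightarrow> fst (prod_decode s) = v k (fst (prod_decode (snd (prod_decode s)))) \<and>
     P (prod_encode (e, prod_encode (Suc (fst (prod_decode (snd (prod_decode s)))), Suc k)))
       (fst (prod_decode (snd (prod_decode (snd (prod_decode s)))))) \<and>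
     (fst (prod_decode (snd (prod_decode s))) = 0 \<or>
      P' (prod_encode (e, prod_encode (fst (prod_decode (snd (prod_decode s))) - 1, Suc k)))
       (snd (prod_decode (snd (prod_decode (snd (prod_decode s)))))))" for e k s
  have "recursive_pred (\<lambda>xs. Q (arg xs 1) (arg xs 2) (arg xs 0))"
    unfolding Q_def v_def by (intro recursive P P')
  moreover have "total_recursive (\<lambda>xs. fst (prod_decode (arg xs 0)))" by (intro recursive)
  ultimately obtain f where f: "partial_recursive f"
    "\<And>e k. \<exists>s. Q e k s \<Longrightarrow> \<exists>s. Q e k s \<and> f [e, k] = Some (fst (prod_decode s))"
    by (rule ex_partial_recursive_search) (simp only: arg_simps)
  have "\<exists>v. f [e, k] = Some v \<and> \<bar>N e - of_rat (nat_to_rat_surj v)\<bar> < 1 / 2 ^ k" if R: "R e" for e k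
  proof -
    let ?u = "2 ^ Suc k :: real"
    \<comment> \<open>A radius code \<open>m\<close> stands for numerator \<open>m + 1\<close>: so
      \<open>Suc m\<close> yields the bound \<open>m + 2\<close> and \<open>m - 1\<close> yields
      \<open>m\<close>. Radii are positive, so there is no lower test for
      \<open>m = 0\<close>.\<close>
    have up: "(\<exists>s. P (prod_encode (e, prod_encode (Suc m, Suc k))) s) \<longleftrightarrow> N e * ?u < real m + 2" for m
      using R by (simp flip: P_iff add: radius_def field_simps)
    have low: "(\<exists>s. P' (prod_encode (e, prod_encode (m - 1, Suc k))) s) \<longleftrightarrow> real m < N e * ?u" if "m \<noteq> 0" for m
      using R that by (simp flip: P'_iff add: radius_def field_simps)
    \<comment> \<open>The largest integer strictly below \<open>N e * ?u\<close>, or 0 if that is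
      negative; it shows that the search succeeds.\<close>
    define m where "m = nat (\<lceil>N e * ?u\<rceil> - 1)"
    have "0 \<le> N e * ?u" using nonneg by simp
    then have "N e * ?u < real m + 2" and lower: "m \<noteq> 0 \<Longrightarrow> real m < N e * ?u"
      unfolding m_def by linarith+
    then obtain s where s: "P (prod_encode (e, prod_encode (Suc m, Suc k))) s"
      using up[of m] by blast
    obtain t where t: "m = 0 \<or> P' (prod_encode (e, prod_encode (m - 1, Suc k))) t"
      using low[of m] lower by (cases "m = 0") auto
    have "Q e k (prod_encode (v k m, prod_encode (m, prod_encode (s, t))))"
      using s t by (simp add: Q_def)
    then obtain s where Q: "Q e k s" and f_eq: "f [e, k] = Some (fst (prod_decode s))"
      using f(2) by blast
    define m' where "m' = fst (prod_decode (snd (prod_decode s)))"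
    have "N e * ?u < real m' + 2" "m' = 0 \<or> real m' < N e * ?u"
      using Q up[of m'] low[of m'] unfolding Q_def m'_def[symmetric] by blast+
    \<comment> \<open>The search may return another \<open>m'\<close>; its two bounds suffice, with
      nonnegativity of \<open>N e\<close> replacing the lower one when
      \<open>m' = 0\<close>.\<close>
    then have "\<bar>N e * ?u - real (Suc m')\<bar> < 2"
      using \<open>0 \<le> N e * ?u\<close> by (auto simp: abs_less_iff)
    then have "\<bar>N e * ?u - real (Suc m')\<bar> / ?u < 2 / ?u"
      by (rule divide_strict_right_mono) simp
    moreover have "\<bar>N e * ?u - real (Suc m')\<bar> / ?u = \<bar>N e - real (Suc m') / ?u\<bar>"
      by (subst abs_div_pos) (simp_all add: diff_divide_distrib del: power_Suc)
    ultimately have "\<bar>N e - of_rat (nat_to_rat_surj (v k m'))\<bar> < 1 / 2 ^ k"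
      unfolding v by simp
    then show ?thesis using f_eq Q by (auto simp: Q_def m'_def)
  qed
  with f(1) show thesis by (rule that)
qed

section \<open>Computable presentations and strongly computable word problems\<close>

theorem theorem3p12:
  fixes K :: "complex set" and n :: enat
    and A :: "'a::banach star_algebra" and a :: "nat \<Rightarrow> 'a"
    and F :: "'f::banach star_algebra" and c :: "nat \<Rightarrow> 'f"
  assumes "K = \<real> \<or> K = UNIV"
    and "cstar_algebra TYPE('h::{real_inner,banach}) K A"
    and "presentation K A n a"
    and "\<And>j. enat j < n \<Longrightarrow> norm (a j) \<le> 1"
    and "universal_contraction_algebra TYPE('k::{real_inner,banach}) TYPE('g::{real_inner,banach}) K n F c"
    and "universal_property TYPE('h) K n F c"
  shows "computable_presentation K A n a \<longleftrightarrow>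
         strongly_computable_closed K F n c (word_problem K n F c A a)"
proof -
  have K: "\<real> \<subseteq> K" using assms(1) by auto
  obtain \<rho> :: "'a \<Rightarrow> 'h \<Rightarrow> 'h" where \<rho>: "represented_star_algebra K A \<rho>"
    by (rule cstar_algebra_represented[OF assms(2) K])
  have "cstar_algebra TYPE('k) K F"
    using assms(5) unfolding universal_contraction_algebra_def by blast
  then obtain \<sigma> :: "'f \<Rightarrow> 'k \<Rightarrow> 'k" where \<sigma>: "represented_star_algebra K F \<sigma>"
    by (rule cstar_algebra_represented[OF _ K])
  define \<pi> where "\<pi> = quotient_map K n F c A a"
  have "star_hom K F A \<pi> \<and> (\<forall>j. enat j < n \<longrightarrow> \<pi> (c j) = a j)"
    unfolding \<pi>_def quotient_map_def by (rule theI'[OF ex1_star_hom[OF assms(2,4,6)]])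
  then have hom: "star_hom K F A \<pi>" and gen: "\<And>j. enat j < n \<Longrightarrow> \<pi> (c j) = a j" by blast+
  interpret represented_star_hom K F \<sigma> A \<rho> \<pi>
    using \<rho> \<sigma> hom by (intro represented_star_hom.intro represented_star_hom_axioms.intro)
  have "a j \<in> closure (range \<pi>)" if "enat j < n" for j
    using gen[OF that] closure_subset by (metis rangeI subsetD)
  then have dense: "closure (range \<pi>) = UNIV"
    using assms(3) closed_star_subalgebra_closure_range unfolding presentation_def by blast
  define R where "R e \<longleftrightarrow> decode_polynomial e \<in> rational_polynomials K n" for e
  define N where "N e = norm (point A a (decode_polynomial e))" for e
  have R: "recursive_pred (\<lambda>xs. R (f xs))" if "total_recursive f" for f
    unfolding R_def by (rule recursive_pred_rational[OF assms(1) that])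
  have N: "N e = norm (\<pi> (point F c (decode_polynomial e)))" if "R e" for e
    using hom_point[of n c a, OF gen] that by (simp add: N_def R_def)
  have wp: "word_problem K n F c A a = {z. \<pi> z = 0}"
    by (simp add: word_problem_def \<pi>_def)
  have ball: "decode_ball b = (decode_polynomial (fst (prod_decode b)), radius (snd (prod_decode b)))" for b
    by (simp add: decode_ball_def radius_def split_beta Let_def)
  have "computable_presentation K A n a \<longleftrightarrow>
      (\<exists>f. partial_recursive f \<and> (\<forall>e k. R e \<longrightarrow>
        (\<exists>v. f [e, k] = Some v \<and> \<bar>N e - of_rat (nat_to_rat_surj v)\<bar> < 1 / 2 ^ k)))"
    by (simp add: computable_presentation_def R_def N_def)
  \<comment> \<open>This equivalence concerns only the real function \<open>N\<close> on codes and
    the decidability of \<open>R\<close>; the algebra returns when the two c.e. sets are read as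
    sets of balls.\<close>
  also have "\<dots> \<longleftrightarrow>
      ce {b. R (fst (prod_decode b)) \<and> N (fst (prod_decode b)) < radius (snd (prod_decode b))} \<and>
      ce {b. R (fst (prod_decode b)) \<and> radius (snd (prod_decode b)) < N (fst (prod_decode b))}"
    (is "?approx \<longleftrightarrow> ?ce")
  proof
    assume ?approx
    then show ?ce using ce_radius_if_approximable[of R N, OF R] by (auto simp: N_def)
  next
    assume ?ce
    moreover have "0 \<le> N e" for e by (simp add: N_def)
    ultimately show ?approx by (elim conjE approximable_if_ce_radius[rotated]) blast+
  qed
  also have "\<dots> \<longleftrightarrow> strongly_computable_closed K F n c (word_problem K n F c A a)"
  proof -
    have "(case decode_ball b of (p, r) \<Rightarrow> p \<in> rational_polynomials K n \<and>
          ball (point F c p) r \<inter> {z. \<pi> z = 0} \<noteq> {}) \<longleftrightarrow>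
        R (fst (prod_decode b)) \<and> N (fst (prod_decode b)) < radius (snd (prod_decode b))"
      and "(case decode_ball b of (p, r) \<Rightarrow> p \<in> rational_polynomials K n \<and>
          cball (point F c p) r \<inter> {z. \<pi> z = 0} = {}) \<longleftrightarrow>
        R (fst (prod_decode b)) \<and> radius (snd (prod_decode b)) < N (fst (prod_decode b))" for b
      unfolding ball split ball_meets_kernel_iff[OF dense] using N by (auto simp: R_def)
    then show ?thesis
      using closed_kernel
      by (simp add: strongly_computable_closed_def ce_closed_def strongly_co_ce_closed_def wp)
  qed
  finally show ?thesis .
qed

end
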